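(* Let $(\mathcal T,\Sigma,\Delta)$ be a triangulated category. (1) Every homotopic morphism of distinguished triangles is middling good. (2) Let $(\alpha,\beta,\gamma)$ be a homotopic morphism of distinguished triangles from $X\xrightarrow{f}Y\xrightarrow{g}Z\xrightarrow{h}\Sigma X$ to $X'\xrightarrow{f'}Y'\xrightarrow{g'}Z'\xrightarrow{h'}\Sigma X'$. If $\mathcal T(Z',\Sigma X)=0$, then $(\alpha,\beta,\gamma)$ is good.
   Context: Let $(\mathcal T,\Sigma,\Delta)$ be a triangulated category. A morphism of distinguished triangles from $X\xrightarrow{f}Y\xrightarrow{g}Z\xrightarrow{h}\Sigma X$ to $X'\xrightarrow{f'}Y'\xrightarrow{g'}Z'\xrightarrow{h'}\Sigma X'$ is a triple $(\alpha,\beta,\gamma)$ with $\beta f=f'\alpha$, $\gamma g=g'\beta$, $(\Sigma\alpha)h=h'\gamma$. Homotopic: ($\mathcal T$ is regarded as an extriangulated category with $\mathbb E(Z,X)=\mathcal T(Z,\Sigma X)$, where $h\in\mathcal T(Z,\Sigma X)$ is realized by the sequence $X\xrightarrow{f}Y\xrightarrow{g}Z$ for which $X\xrightarrow{f}Y\xrightarrow{g}Z\xrightarrow{h}\Sigma X$ is distinguished.) The morphism $(\alpha,\beta,\gamma)$ is homotopic if there are a distinguished triangle $X'\xrightarrow{s}E\xrightarrow{t}Z\xrightarrow{\eta}\Sigma X'$ and morphisms $\beta_1:Y\to E$, $\beta_2:E\to Y'$ with $\beta=\beta_2\beta_1$, such that $(\alpha,\beta_1,1_Z)$ and $(1_{X'},\beta_2,\gamma)$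 are morphisms of distinguished triangles (in particular $\eta=(\Sigma\alpha)h=h'\gamma$), and $X\xrightarrow{\left(\begin{smallmatrix}f\\ \alpha\end{smallmatrix}\right)}Y\oplus X'\xrightarrow{(\beta_1,-s)}E\xrightarrow{ht}\Sigma X$ and $E\xrightarrow{\left(\begin{smallmatrix}-t\\ \beta_2\end{smallmatrix}\right)}Z\oplus Y'\xrightarrow{(\gamma,g')}Z'\xrightarrow{(\Sigma s)h'}\Sigma E$ are distinguished triangles. Good (Neeman): $(\alpha,\beta,\gamma)$ is good if the mapping cone $$Y\oplus X'\xrightarrow{\left(\begin{smallmatrix}-g&0\\ \beta&f'\end{smallmatrix}\right)}Z\oplus Y'\xrightarrow{\left(\begin{smallmatrix}-h&0\\ \gamma&g'\end{smallmatrix}\right)}\Sigma X\oplus Z'\xrightarrow{\left(\begin{smallmatrix}-\Sigma f&0\\ \Sigma\alpha&h'\end{smallmatrix}\right)}\Sigma Y\oplus\Sigma X'$$ is a distinguished triangle. Middling good (Neeman): $(\alpha,\beta,\gamma)$ is middling good if it extends to a $4\times4$ diagram with rows $X\xrightarrow{f}Y\xrightarrow{g}Z\xrightarrow{h}\Sigma X$, $X'\xrightarrow{f'}Y'\xrightarrow{g'}Z'\xrightarrow{h'}\Sigma X'$, $X''\xrightarrow{f''}Y''\xrightarrow{g''}Z''\xrightarrow{h''}\Sigma X''$, $\Sigma X\xrightarrow{\Sigma f}\Sigma Y\xrightarrow{\Sigma g}\Sigma Z\xrightarrow{-\Sigma h}\Sigma^2X$ and columns $X\xrightarrow{\alpha}X'\xrightarrow{\alpha'}X''\xrightarrow{\alpha''}\Sigma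 X$, $Y\xrightarrow{\beta}Y'\xrightarrow{\beta'}Y''\xrightarrow{\beta''}\Sigma Y$, $Z\xrightarrow{\gamma}Z'\xrightarrow{\gamma'}Z''\xrightarrow{\gamma''}\Sigma Z$, $\Sigma X\xrightarrow{\Sigma\alpha}\Sigma X'\xrightarrow{\Sigma\alpha'}\Sigma X''\xrightarrow{-\Sigma\alpha''}\Sigma^2X$, in which all rows and columns are distinguished triangles and all squares commute except the bottom right one, which satisfies $(\Sigma\alpha'')h''=-(\Sigma h)\gamma''$. *)

theory Defs
  imports "HOL-Algebra.Group"
begin

record ('o, 'm) category_data =
  Obj :: "'o set"
  Arr :: "'m set"
  Dom :: "'m \<Rightarrow> 'o"
  Cod :: "'m \<Rightarrow> 'o"
  Idm :: "'o \<Rightarrow> 'm"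
  Comp :: "'m \<Rightarrow> 'm \<Rightarrow> 'm"  (infixr "\<cdot>\<index>" 70)

definition Hom :: "('o, 'm, 'x) category_data_scheme \<Rightarrow> 'o \<Rightarrow> 'o \<Rightarrow> 'm set" where
  "Hom C X Y = {f \<in> Arr C. Dom C f = X \<and> Cod C f = Y}"

text \<open>\<open>g \<cdot>\<^bsub>C\<^esub> f\<close> is the composite ``first \<open>f\<close>, then \<open>g\<close>''.\<close>

locale category =
  fixes C :: "('o, 'm, 'x) category_data_scheme" (structure)
  assumes Dom_Obj: "f \<in> Arr C \<Longrightarrow> Dom C f \<in> Obj C"
    and Cod_Obj: "f \<in> Arr C \<Longrightarrow> Cod C f \<in> Obj C"
    and Idm_Hom: "X \<in> Obj C \<Longrightarrow> Idm C X \<in> Hom C X X"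
    and Comp_Hom: "f \<in> Hom C X Y \<Longrightarrow> g \<in> Hom C Y Z \<Longrightarrow> g \<cdot> f \<in> Hom C X Z"
    and Comp_Idm: "f \<in> Hom C X Y \<Longrightarrow> f \<cdot> Idm C X = f"
    and Idm_Comp: "f \<in> Hom C X Y \<Longrightarrow> Idm C Y \<cdot> f = f"
    and Comp_assoc: "f \<in> Hom C W X \<Longrightarrow> g \<in> Hom C X Y \<Longrightarrow> h \<in> Hom C Y Z \<Longrightarrow>
          (h \<cdot> g) \<cdot> f = h \<cdot> (g \<cdot> f)"

definition is_iso :: "('o, 'm, 'x) category_data_scheme \<Rightarrow> 'o \<Rightarrow> 'o \<Rightarrow> 'm \<Rightarrow> bool" where
  "is_iso C X Y f \<longleftrightarrow> f \<in> Hom C X Y \<and>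
     (\<exists>g \<in> Hom C Y X. g \<cdot>\<^bsub>C\<^esub> f = Idm C X \<and> f \<cdot>\<^bsub>C\<^esub> g = Idm C Y)"

definition is_zero_object :: "('o, 'm, 'x) category_data_scheme \<Rightarrow> 'o \<Rightarrow> bool" where
  "is_zero_object C O' \<longleftrightarrow> O' \<in> Obj C \<and>
     (\<forall>X \<in> Obj C. (\<exists>!f. f \<in> Hom C X O') \<and> (\<exists>!f. f \<in> Hom C O' X))"

record ('o, 'm) additive_data = "('o, 'm) category_data" +
  Add :: "'m \<Rightarrow> 'm \<Rightarrow> 'm"  (infixl "\<boxplus>\<index>" 65)
  Zero :: "'o \<Rightarrow> 'o \<Rightarrow> 'm"

definition hom_group :: "('o, 'm, 'x) additive_data_scheme \<Rightarrow> 'o \<Rightarrow> 'o \<Rightarrow> 'm monoid" where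
  "hom_group C X Y = \<lparr>carrier = Hom C X Y, mult = Add C, one = Zero C X Y\<rparr>"

definition Neg :: "('o, 'm, 'x) additive_data_scheme \<Rightarrow> 'm \<Rightarrow> 'm" where
  "Neg C f = inv\<^bsub>hom_group C (Dom C f) (Cod C f)\<^esub> f"

definition is_biproduct ::
  "('o, 'm, 'x) additive_data_scheme \<Rightarrow> 'o \<Rightarrow> 'o \<Rightarrow> 'o \<times> 'm \<times> 'm \<times> 'm \<times> 'm \<Rightarrow> bool" where
  "is_biproduct C A B = (\<lambda>(P, i\<^sub>1, i\<^sub>2, p\<^sub>1, p\<^sub>2).
     i\<^sub>1 \<in> Hom C A P \<and> i\<^sub>2 \<in> Hom C B P \<and> p\<^sub>1 \<in> Hom C P A \<and> p\<^sub>2 \<in> Hom C P B \<and>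
     p\<^sub>1 \<cdot>\<^bsub>C\<^esub> i\<^sub>1 = Idm C A \<and> p\<^sub>2 \<cdot>\<^bsub>C\<^esub> i\<^sub>2 = Idm C B \<and>
     p\<^sub>1 \<cdot>\<^bsub>C\<^esub> i\<^sub>2 = Zero C B A \<and> p\<^sub>2 \<cdot>\<^bsub>C\<^esub> i\<^sub>1 = Zero C A B \<and>
     i\<^sub>1 \<cdot>\<^bsub>C\<^esub> p\<^sub>1 \<boxplus>\<^bsub>C\<^esub> i\<^sub>2 \<cdot>\<^bsub>C\<^esub> p\<^sub>2 = Idm C P)"

locale additive_category = category C
  for C :: "('o, 'm, 'x) additive_data_scheme" (structure) +
  assumes hom_comm_group: "X \<in> Obj C \<Longrightarrow> Y \<in> Obj C \<Longrightarrow> comm_group (hom_group C X Y)"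
    and Comp_Add_left: "f \<in> Hom C X Y \<Longrightarrow> g \<in> Hom C Y Z \<Longrightarrow> g' \<in> Hom C Y Z \<Longrightarrow>
          (g \<boxplus> g') \<cdot> f = g \<cdot> f \<boxplus> g' \<cdot> f"
    and Comp_Add_right: "f \<in> Hom C X Y \<Longrightarrow> f' \<in> Hom C X Y \<Longrightarrow> g \<in> Hom C Y Z \<Longrightarrow>
          g \<cdot> (f \<boxplus> f') = g \<cdot> f \<boxplus> g \<cdot> f'"
    and ex_zero_object: "\<exists>O'. is_zero_object C O'"
    and ex_biproduct: "A \<in> Obj C \<Longrightarrow> B \<in> Obj C \<Longrightarrow> \<exists>b. is_biproduct C A B b"

text \<open>A chosen biproduct \<open>A \<oplus> B\<close>, with its injections and projections.  Another choice changes
  the triangles below only by an isomorphism of triangles.\<close>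

definition biproduct ::
  "('o, 'm, 'x) additive_data_scheme \<Rightarrow> 'o \<Rightarrow> 'o \<Rightarrow> 'o \<times> 'm \<times> 'm \<times> 'm \<times> 'm" where
  "biproduct C A B = (SOME b. is_biproduct C A B b)"

definition Biprod :: "('o, 'm, 'x) additive_data_scheme \<Rightarrow> 'o \<Rightarrow> 'o \<Rightarrow> 'o"
    (infixl "\<oplus>\<index>" 65) where
  "A \<oplus>\<^bsub>C\<^esub> B = (case biproduct C A B of (P, i\<^sub>1, i\<^sub>2, p\<^sub>1, p\<^sub>2) \<Rightarrow> P)"

definition In1 :: "('o, 'm, 'x) additive_data_scheme \<Rightarrow> 'o \<Rightarrow> 'o \<Rightarrow> 'm" where
  "In1 C A B = (case biproduct C A B of (P, i\<^sub>1, i\<^sub>2, p\<^sub>1, p\<^sub>2) \<Rightarrow> i\<^sub>1)"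

definition In2 :: "('o, 'm, 'x) additive_data_scheme \<Rightarrow> 'o \<Rightarrow> 'o \<Rightarrow> 'm" where
  "In2 C A B = (case biproduct C A B of (P, i\<^sub>1, i\<^sub>2, p\<^sub>1, p\<^sub>2) \<Rightarrow> i\<^sub>2)"

definition Pr1 :: "('o, 'm, 'x) additive_data_scheme \<Rightarrow> 'o \<Rightarrow> 'o \<Rightarrow> 'm" where
  "Pr1 C A B = (case biproduct C A B of (P, i\<^sub>1, i\<^sub>2, p\<^sub>1, p\<^sub>2) \<Rightarrow> p\<^sub>1)"

definition Pr2 :: "('o, 'm, 'x) additive_data_scheme \<Rightarrow> 'o \<Rightarrow> 'o \<Rightarrow> 'm" where
  "Pr2 C A B = (case biproduct C A B of (P, i\<^sub>1, i\<^sub>2, p\<^sub>1, p\<^sub>2) \<Rightarrow> p\<^sub>2)"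

text \<open>\<open>col C a b : X \<rightarrow> A \<oplus> B\<close> for \<open>a : X \<rightarrow> A\<close>, \<open>b : X \<rightarrow> B\<close>;
  \<open>row C a b : A \<oplus> B \<rightarrow> X\<close> for \<open>a : A \<rightarrow> X\<close>, \<open>b : B \<rightarrow> X\<close>;
  \<open>mat C a b c d\<close> has first row \<open>a, b\<close> and second row \<open>c, d\<close>.\<close>

definition col :: "('o, 'm, 'x) additive_data_scheme \<Rightarrow> 'm \<Rightarrow> 'm \<Rightarrow> 'm" where
  "col C a b = In1 C (Cod C a) (Cod C b) \<cdot>\<^bsub>C\<^esub> a \<boxplus>\<^bsub>C\<^esub> In2 C (Cod C a) (Cod C b) \<cdot>\<^bsub>C\<^esub> b"

definition row :: "('o, 'm, 'x) additive_data_scheme \<Rightarrow> 'm \<Rightarrow> 'm \<Rightarrow> 'm" where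
  "row C a b = a \<cdot>\<^bsub>C\<^esub> Pr1 C (Dom C a) (Dom C b) \<boxplus>\<^bsub>C\<^esub> b \<cdot>\<^bsub>C\<^esub> Pr2 C (Dom C a) (Dom C b)"

definition mat :: "('o, 'm, 'x) additive_data_scheme \<Rightarrow> 'm \<Rightarrow> 'm \<Rightarrow> 'm \<Rightarrow> 'm \<Rightarrow> 'm" where
  "mat C a b c d = col C (row C a b) (row C c d)"

text \<open>The tuple \<open>(X, f, Y, g, Z, h)\<close> stands for \<open>X \<rightarrow> Y \<rightarrow> Z \<rightarrow> \<Sigma>X\<close> with the morphisms
  \<open>f\<close>, \<open>g\<close>, \<open>h\<close>.\<close>

type_synonym ('o, 'm) triangle = "'o \<times> 'm \<times> 'o \<times> 'm \<times> 'o \<times> 'm"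

record ('o, 'm) triangulated_data = "('o, 'm) additive_data" +
  SuspO :: "'o \<Rightarrow> 'o"  ("\<Sigma>\<^sub>o\<index>")
  Susp :: "'m \<Rightarrow> 'm"  ("\<Sigma>\<index>")
  Dist :: "('o, 'm) triangle set"  ("\<Delta>\<index>")

fun is_triangle :: "('o, 'm, 'x) triangulated_data_scheme \<Rightarrow> ('o, 'm) triangle \<Rightarrow> bool" where
  "is_triangle T (X, f, Y, g, Z, h) \<longleftrightarrow>
     f \<in> Hom T X Y \<and> g \<in> Hom T Y Z \<and> h \<in> Hom T Z (\<Sigma>\<^sub>o\<^bsub>T\<^esub> X)"

fun triangle_morphism :: "('o, 'm, 'x) triangulated_data_scheme \<Rightarrow>
    ('o, 'm) triangle \<Rightarrow> ('o, 'm) triangle \<Rightarrow> 'm \<times> 'm \<times> 'm \<Rightarrow> bool" where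
  "triangle_morphism T (X, f, Y, g, Z, h) (X', f', Y', g', Z', h') (\<alpha>, \<beta>, \<gamma>) \<longleftrightarrow>
     \<alpha> \<in> Hom T X X' \<and> \<beta> \<in> Hom T Y Y' \<and> \<gamma> \<in> Hom T Z Z' \<and>
     \<beta> \<cdot>\<^bsub>T\<^esub> f = f' \<cdot>\<^bsub>T\<^esub> \<alpha> \<and> \<gamma> \<cdot>\<^bsub>T\<^esub> g = g' \<cdot>\<^bsub>T\<^esub> \<beta> \<and> \<Sigma>\<^bsub>T\<^esub> \<alpha> \<cdot>\<^bsub>T\<^esub> h = h' \<cdot>\<^bsub>T\<^esub> \<gamma>"

text \<open>\<open>\<Sigma>\<close> is only required to be an additive autoequivalence, not an automorphism.\<close>

locale triangulated_category = additive_category T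
  for T :: "('o, 'm, 'x) triangulated_data_scheme" (structure) +
  assumes SuspO_Obj: "X \<in> Obj T \<Longrightarrow> \<Sigma>\<^sub>o X \<in> Obj T"
    and Susp_Hom: "f \<in> Hom T X Y \<Longrightarrow> \<Sigma> f \<in> Hom T (\<Sigma>\<^sub>o X) (\<Sigma>\<^sub>o Y)"
    and Susp_Idm: "X \<in> Obj T \<Longrightarrow> \<Sigma> (Idm T X) = Idm T (\<Sigma>\<^sub>o X)"
    and Susp_Comp: "f \<in> Hom T X Y \<Longrightarrow> g \<in> Hom T Y Z \<Longrightarrow> \<Sigma> (g \<cdot> f) = \<Sigma> g \<cdot> \<Sigma> f"
    and Susp_Add: "f \<in> Hom T X Y \<Longrightarrow> f' \<in> Hom T X Y \<Longrightarrow> \<Sigma> (f \<boxplus> f') = \<Sigma> f \<boxplus> \<Sigma> f'"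
    and Susp_fully_faithful: "X \<in> Obj T \<Longrightarrow> Y \<in> Obj T \<Longrightarrow>
          bij_betw \<Sigma> (Hom T X Y) (Hom T (\<Sigma>\<^sub>o X) (\<Sigma>\<^sub>o Y))"
    and Susp_ess_surj: "Y \<in> Obj T \<Longrightarrow> \<exists>X \<in> Obj T. \<exists>u. is_iso T (\<Sigma>\<^sub>o X) Y u"
    and Dist_triangle: "D \<in> \<Delta> \<Longrightarrow> is_triangle T D"
    and TR1_iso: "(X, f, Y, g, Z, h) \<in> \<Delta> \<Longrightarrow> is_triangle T (X', f', Y', g', Z', h') \<Longrightarrow>
          triangle_morphism T (X, f, Y, g, Z, h) (X', f', Y', g', Z', h') (\<alpha>, \<beta>, \<gamma>) \<Longrightarrow>
          is_iso T X X' \<alpha> \<Longrightarrow> is_iso T Y Y' \<beta> \<Longrightarrow> is_iso T Z Z' \<gamma> \<Longrightarrow>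
          (X', f', Y', g', Z', h') \<in> \<Delta>"
    and TR1_id: "X \<in> Obj T \<Longrightarrow> is_zero_object T O' \<Longrightarrow>
          (X, Idm T X, X, Zero T X O', O', Zero T O' (\<Sigma>\<^sub>o X)) \<in> \<Delta>"
    and TR1_ex: "f \<in> Hom T X Y \<Longrightarrow> \<exists>Z g h. (X, f, Y, g, Z, h) \<in> \<Delta>"
    and TR2: "is_triangle T (X, f, Y, g, Z, h) \<Longrightarrow>
          (X, f, Y, g, Z, h) \<in> \<Delta> \<longleftrightarrow> (Y, g, Z, h, \<Sigma>\<^sub>o X, Neg T (\<Sigma> f)) \<in> \<Delta>"
    and TR3: "(X, f, Y, g, Z, h) \<in> \<Delta> \<Longrightarrow> (X', f', Y', g', Z', h') \<in> \<Delta> \<Longrightarrow>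
          \<alpha> \<in> Hom T X X' \<Longrightarrow> \<beta> \<in> Hom T Y Y' \<Longrightarrow> \<beta> \<cdot> f = f' \<cdot> \<alpha> \<Longrightarrow>
          \<exists>\<gamma>. triangle_morphism T (X, f, Y, g, Z, h) (X', f', Y', g', Z', h') (\<alpha>, \<beta>, \<gamma>)"
    and TR4: "(X, u, Y, u', U, u'') \<in> \<Delta> \<Longrightarrow> (Y, v, Z, v', V, v'') \<in> \<Delta> \<Longrightarrow>
          (X, v \<cdot> u, Z, w', W, w'') \<in> \<Delta> \<Longrightarrow>
          \<exists>a b. (U, a, W, b, V, \<Sigma> u' \<cdot> v'') \<in> \<Delta> \<and>
            a \<cdot> u' = w' \<cdot> v \<and> w'' \<cdot> a = u'' \<and> b \<cdot> w' = v' \<and> v'' \<cdot> b = \<Sigma> u \<cdot> w''"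

fun homotopic :: "('o, 'm, 'x) triangulated_data_scheme \<Rightarrow>
    ('o, 'm) triangle \<Rightarrow> ('o, 'm) triangle \<Rightarrow> 'm \<times> 'm \<times> 'm \<Rightarrow> bool" where
  "homotopic T (X, f, Y, g, Z, h) (X', f', Y', g', Z', h') (\<alpha>, \<beta>, \<gamma>) \<longleftrightarrow>
     (\<exists>E s t \<eta> \<beta>\<^sub>1 \<beta>\<^sub>2.
        (X', s, E, t, Z, \<eta>) \<in> \<Delta>\<^bsub>T\<^esub> \<and>
        \<beta>\<^sub>1 \<in> Hom T Y E \<and> \<beta>\<^sub>2 \<in> Hom T E Y' \<and> \<beta> = \<beta>\<^sub>2 \<cdot>\<^bsub>T\<^esub> \<beta>\<^sub>1 \<and>
        triangle_morphism T (X, f, Y, g, Z, h) (X', s, E, t, Z, \<eta>) (\<alpha>, \<beta>\<^sub>1, Idm T Z) \<and>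
        triangle_morphism T (X', s, E, t, Z, \<eta>) (X', f', Y', g', Z', h') (Idm T X', \<beta>\<^sub>2, \<gamma>) \<and>
        (X, col T f \<alpha>, Y \<oplus>\<^bsub>T\<^esub> X', row T \<beta>\<^sub>1 (Neg T s), E, h \<cdot>\<^bsub>T\<^esub> t) \<in> \<Delta>\<^bsub>T\<^esub> \<and>
        (E, col T (Neg T t) \<beta>\<^sub>2, Z \<oplus>\<^bsub>T\<^esub> Y', row T \<gamma> g', Z', \<Sigma>\<^bsub>T\<^esub> s \<cdot>\<^bsub>T\<^esub> h') \<in> \<Delta>\<^bsub>T\<^esub>)"

text \<open>The last morphism of the mapping cone is written with target \<open>\<Sigma>Y \<oplus> \<Sigma>X'\<close>; as part of a
  triangle it must end in \<open>\<Sigma>(Y \<oplus> X')\<close>, so it is composed with the canonical isomorphism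
  \<open>(\<Sigma>i\<^sub>1, \<Sigma>i\<^sub>2) : \<Sigma>A \<oplus> \<Sigma>B \<rightarrow> \<Sigma>(A \<oplus> B)\<close>.\<close>

definition Susp_Biprod :: "('o, 'm, 'x) triangulated_data_scheme \<Rightarrow> 'o \<Rightarrow> 'o \<Rightarrow> 'm" where
  "Susp_Biprod T A B = row T (\<Sigma>\<^bsub>T\<^esub> (In1 T A B)) (\<Sigma>\<^bsub>T\<^esub> (In2 T A B))"

fun good :: "('o, 'm, 'x) triangulated_data_scheme \<Rightarrow>
    ('o, 'm) triangle \<Rightarrow> ('o, 'm) triangle \<Rightarrow> 'm \<times> 'm \<times> 'm \<Rightarrow> bool" where
  "good T (X, f, Y, g, Z, h) (X', f', Y', g', Z', h') (\<alpha>, \<beta>, \<gamma>) \<longleftrightarrow>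
     (Y \<oplus>\<^bsub>T\<^esub> X',
      mat T (Neg T g) (Zero T X' Z)
            \<beta>         f',
      Z \<oplus>\<^bsub>T\<^esub> Y',
      mat T (Neg T h) (Zero T Y' (\<Sigma>\<^sub>o\<^bsub>T\<^esub> X))
            \<gamma>         g',
      \<Sigma>\<^sub>o\<^bsub>T\<^esub> X \<oplus>\<^bsub>T\<^esub> Z',
      Susp_Biprod T Y X' \<cdot>\<^bsub>T\<^esub>
      mat T (Neg T (\<Sigma>\<^bsub>T\<^esub> f)) (Zero T Z' (\<Sigma>\<^sub>o\<^bsub>T\<^esub> Y))
            (\<Sigma>\<^bsub>T\<^esub> \<alpha>)         h') \<in> \<Delta>\<^bsub>T\<^esub>"

fun middling_good :: "('o, 'm, 'x) triangulated_data_scheme \<Rightarrow>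
    ('o, 'm) triangle \<Rightarrow> ('o, 'm) triangle \<Rightarrow> 'm \<times> 'm \<times> 'm \<Rightarrow> bool" where
  "middling_good T (X, f, Y, g, Z, h) (X', f', Y', g', Z', h') (\<alpha>, \<beta>, \<gamma>) \<longleftrightarrow>
     (\<exists>X'' Y'' Z'' f'' g'' h'' \<alpha>' \<alpha>'' \<beta>' \<beta>'' \<gamma>' \<gamma>''.
        (X, f, Y, g, Z, h) \<in> \<Delta>\<^bsub>T\<^esub> \<and>
        (X', f', Y', g', Z', h') \<in> \<Delta>\<^bsub>T\<^esub> \<and>
        (X'', f'', Y'', g'', Z'', h'') \<in> \<Delta>\<^bsub>T\<^esub> \<and>
        (\<Sigma>\<^sub>o\<^bsub>T\<^esub> X, \<Sigma>\<^bsub>T\<^esub> f, \<Sigma>\<^sub>o\<^bsub>T\<^esub> Y, \<Sigma>\<^bsub>T\<^esub> g, \<Sigma>\<^sub>o\<^bsub>T\<^esub> Z, Neg T (\<Sigma>\<^bsub>T\<^esub> h)) \<in> \<Delta>\<^bsub>T\<^esub> \<and>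
        (X, \<alpha>, X', \<alpha>', X'', \<alpha>'') \<in> \<Delta>\<^bsub>T\<^esub> \<and>
        (Y, \<beta>, Y', \<beta>', Y'', \<beta>'') \<in> \<Delta>\<^bsub>T\<^esub> \<and>
        (Z, \<gamma>, Z', \<gamma>', Z'', \<gamma>'') \<in> \<Delta>\<^bsub>T\<^esub> \<and>
        (\<Sigma>\<^sub>o\<^bsub>T\<^esub> X, \<Sigma>\<^bsub>T\<^esub> \<alpha>, \<Sigma>\<^sub>o\<^bsub>T\<^esub> X', \<Sigma>\<^bsub>T\<^esub> \<alpha>', \<Sigma>\<^sub>o\<^bsub>T\<^esub> X'', Neg T (\<Sigma>\<^bsub>T\<^esub> \<alpha>'')) \<in> \<Delta>\<^bsub>T\<^esub> \<and>
        \<beta> \<cdot>\<^bsub>T\<^esub> f = f' \<cdot>\<^bsub>T\<^esub> \<alpha> \<and>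
        \<gamma> \<cdot>\<^bsub>T\<^esub> g = g' \<cdot>\<^bsub>T\<^esub> \<beta> \<and>
        \<Sigma>\<^bsub>T\<^esub> \<alpha> \<cdot>\<^bsub>T\<^esub> h = h' \<cdot>\<^bsub>T\<^esub> \<gamma> \<and>
        \<beta>' \<cdot>\<^bsub>T\<^esub> f' = f'' \<cdot>\<^bsub>T\<^esub> \<alpha>' \<and>
        \<gamma>' \<cdot>\<^bsub>T\<^esub> g' = g'' \<cdot>\<^bsub>T\<^esub> \<beta>' \<and>
        \<Sigma>\<^bsub>T\<^esub> \<alpha>' \<cdot>\<^bsub>T\<^esub> h' = h'' \<cdot>\<^bsub>T\<^esub> \<gamma>' \<and>
        \<beta>'' \<cdot>\<^bsub>T\<^esub> f'' = \<Sigma>\<^bsub>T\<^esub> f \<cdot>\<^bsub>T\<^esub> \<alpha>'' \<and>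
        \<gamma>'' \<cdot>\<^bsub>T\<^esub> g'' = \<Sigma>\<^bsub>T\<^esub> g \<cdot>\<^bsub>T\<^esub> \<beta>'' \<and>
        \<Sigma>\<^bsub>T\<^esub> \<alpha>'' \<cdot>\<^bsub>T\<^esub> h'' = Neg T (\<Sigma>\<^bsub>T\<^esub> h \<cdot>\<^bsub>T\<^esub> \<gamma>''))"

end

theory Submission
  imports Defs
begin

text \<open>
  A homotopic morphism factors through the triangle \<open>X' \<rightarrow> E \<rightarrow> Z \<rightarrow> \<Sigma>X'\<close>, and the two extra triangles
  in its definition say that the squares \<open>X, Y, X', E\<close> and \<open>E, Z, Y', Z'\<close> are homotopy cartesian.
  Everything follows from this and the octahedral axiom.

  Middling good.  Parallel sides of a homotopy cartesian square have the same cone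
  (\<open>homotopy_square_cone\<close>).  So the cone \<open>X''\<close> of \<open>\<alpha>\<close> is also a cone of \<open>\<beta>\<^sub>1 : Y \<rightarrow> E\<close>, and the cone
  \<open>Z''\<close> of \<open>\<beta>\<^sub>2 : E \<rightarrow> Y'\<close> is also a cone of \<open>\<gamma>\<close>.  Since \<open>\<beta> = \<beta>\<^sub>2 \<cdot> \<beta>\<^sub>1\<close>, the octahedral axiom gives a
  triangle \<open>X'' \<rightarrow> Y'' \<rightarrow> Z'' \<rightarrow> \<Sigma>X''\<close> on the cones of \<open>\<beta>\<^sub>1\<close>, \<open>\<beta>\<close> and \<open>\<beta>\<^sub>2\<close>; it is the third row of the
  required diagram, and the squares commute because the identifications of the cones are compatible
  with the connecting morphisms.

  Good.  The first morphism of the mapping cone factors as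
  \<open>Y \<oplus> X' \<rightarrow> E \<rightarrow> Z \<oplus> Y'\<close> with the maps \<open>(\<beta>\<^sub>1, s)\<close> and \<open>(-t, \<beta>\<^sub>2)\<close>, whose cones are \<open>\<Sigma>X\<close> and \<open>Z'\<close>.  The
  octahedral axiom puts the cone \<open>W\<close> of the composite into a triangle \<open>\<Sigma>X \<rightarrow> W \<rightarrow> Z' \<rightarrow> \<Sigma>\<^sup>2X\<close>.  Its
  last morphism contains the factor \<open>t \<cdot> s = 0\<close>, so \<open>W\<close> is a direct sum of \<open>\<Sigma>X\<close> and \<open>Z'\<close>.  In general
  the matrices of \<open>Z \<oplus> Y' \<rightarrow> W\<close> and \<open>W \<rightarrow> \<Sigma>(Y \<oplus> X')\<close> differ from those of the mapping cone by terms that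
  factor through morphisms \<open>Z' \<rightarrow> \<Sigma>X\<close>; when these all vanish, \<open>W\<close> gives exactly the mapping cone.
\<close>

section \<open>Categories\<close>

text \<open>
  Hom-membership is split into conditions on \<open>Arr\<close>, \<open>Dom\<close> and \<open>Cod\<close>, which rewriting can discharge:
  in \<open>Comp_Hom\<close> the intermediate object occurs only in the premises, so as a rewrite rule it would
  have to be guessed.
\<close>

lemma in_Hom: "f \<in> Hom C X Y \<longleftrightarrow> f \<in> Arr C \<and> Dom C f = X \<and> Cod C f = Y"
  by (auto simp: Hom_def)

context category
begin

lemma Obj_DomCod [simp]: "f \<in> Arr C \<Longrightarrow> Dom C f \<in> Obj C" "f \<in> Arr C \<Longrightarrow> Cod C f \<in> Obj C"
  by (fact Dom_Obj Cod_Obj)+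

lemma Idm_simps [simp]:
  assumes "X \<in> Obj C"
  shows "Idm C X \<in> Arr C" "Dom C (Idm C X) = X" "Cod C (Idm C X) = X"
  using Idm_Hom[OF assms] by (auto simp: in_Hom)

lemma Comp_simps [simp]:
  assumes "f \<in> Arr C" "g \<in> Arr C" "Dom C g = Cod C f"
  shows "g \<cdot> f \<in> Arr C" "Dom C (g \<cdot> f) = Dom C f" "Cod C (g \<cdot> f) = Cod C g"
  using Comp_Hom[of f "Dom C f" "Cod C f" g "Cod C g"] assms by (auto simp: in_Hom)

lemma Comp_Idm' [simp]: "f \<in> Arr C \<Longrightarrow> Dom C f = X \<Longrightarrow> f \<cdot> Idm C X = f"
  and Idm_Comp' [simp]: "f \<in> Arr C \<Longrightarrow> Cod C f = Y \<Longrightarrow> Idm C Y \<cdot> f = f"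
  using Comp_Idm Idm_Comp by (auto simp: in_Hom)

lemma Comp_assoc' [simp]:
  "f \<in> Arr C \<Longrightarrow> g \<in> Arr C \<Longrightarrow> h \<in> Arr C \<Longrightarrow> Dom C g = Cod C f \<Longrightarrow> Dom C h = Cod C g \<Longrightarrow>
    (h \<cdot> g) \<cdot> f = h \<cdot> (g \<cdot> f)"
  using Comp_assoc[of f "Dom C f" "Cod C f" g "Cod C g" h "Cod C h"] by (auto simp: in_Hom)

text \<open>
  Composites are normalised to the right, so an equation for \<open>g \<cdot> f\<close> does not match inside
  \<open>g \<cdot> (f \<cdot> e)\<close>; this form of the equation does.
\<close>

lemma Comp_left:
  assumes "g \<cdot> f = k" "e \<in> Arr C" "f \<in> Arr C" "g \<in> Arr C" "Dom C g = Cod C f" "Dom C f = Cod C e"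
  shows "g \<cdot> (f \<cdot> e) = k \<cdot> e"
  using assms(1)[symmetric] assms(2-) by simp

lemma is_isoI:
  assumes "f \<in> Arr C" "Dom C f = X" "Cod C f = Y" "g \<in> Arr C" "Dom C g = Y" "Cod C g = X"
    and "g \<cdot> f = Idm C X" "f \<cdot> g = Idm C Y"
  shows "is_iso C X Y f"
  using assms by (auto simp: is_iso_def in_Hom)

lemma is_iso_Idm [simp]: "X \<in> Obj C \<Longrightarrow> is_iso C X X (Idm C X)"
  by (rule is_isoI[where g = "Idm C X"]) auto

end

section \<open>Additive categories and biproducts\<close>

context additive_category
begin

lemma hom_group_at: "f \<in> Arr C \<Longrightarrow> comm_group (hom_group C (Dom C f) (Cod C f))"
  by (simp add: hom_comm_group)

lemma Add_simps [simp]: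
  assumes "f \<in> Arr C" "g \<in> Arr C" "Dom C g = Dom C f" "Cod C g = Cod C f"
  shows "f \<boxplus> g \<in> Arr C" "Dom C (f \<boxplus> g) = Dom C f" "Cod C (f \<boxplus> g) = Cod C f"
proof -
  interpret comm_group "hom_group C (Dom C f) (Cod C f)" by (rule hom_group_at[OF assms(1)])
  show "f \<boxplus> g \<in> Arr C" "Dom C (f \<boxplus> g) = Dom C f" "Cod C (f \<boxplus> g) = Cod C f"
    using m_closed[of f g] assms by (auto simp: hom_group_def in_Hom)
qed

lemma Zero_simps [simp]:
  assumes "X \<in> Obj C" "Y \<in> Obj C"
  shows "Zero C X Y \<in> Arr C" "Dom C (Zero C X Y) = X" "Cod C (Zero C X Y) = Y"
proof -
  interpret comm_group "hom_group C X Y" by (rule hom_comm_group[OF assms])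
  show "Zero C X Y \<in> Arr C" "Dom C (Zero C X Y) = X" "Cod C (Zero C X Y) = Y"
    using one_closed by (auto simp: hom_group_def in_Hom)
qed

lemma Neg_simps [simp]:
  assumes "f \<in> Arr C"
  shows "Neg C f \<in> Arr C" "Dom C (Neg C f) = Dom C f" "Cod C (Neg C f) = Cod C f"
proof -
  interpret comm_group "hom_group C (Dom C f) (Cod C f)" by (rule hom_group_at[OF assms])
  show "Neg C f \<in> Arr C" "Dom C (Neg C f) = Dom C f" "Cod C (Neg C f) = Cod C f"
    using inv_closed[of f] assms by (auto simp: hom_group_def Neg_def in_Hom)
qed

lemma Add_group:
  assumes "f \<in> Arr C"
  shows Add_Neg [simp]: "f \<boxplus> Neg C f = Zero C (Dom C f) (Cod C f)"
    and Neg_Add [simp]: "Neg C f \<boxplus> f = Zero C (Dom C f) (Cod C f)"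
    and Neg_Neg [simp]: "Neg C (Neg C f) = f"
    and Zero_Add [simp]: "Dom C f = X \<Longrightarrow> Cod C f = Y \<Longrightarrow> Zero C X Y \<boxplus> f = f"
    and Add_Zero [simp]: "Dom C f = X \<Longrightarrow> Cod C f = Y \<Longrightarrow> f \<boxplus> Zero C X Y = f"
proof -
  interpret comm_group "hom_group C (Dom C f) (Cod C f)" by (rule hom_group_at[OF assms])
  have f: "f \<in> carrier (hom_group C (Dom C f) (Cod C f))"
    using assms by (simp add: hom_group_def in_Hom)
  show "f \<boxplus> Neg C f = Zero C (Dom C f) (Cod C f)"
    and "Neg C f \<boxplus> f = Zero C (Dom C f) (Cod C f)"
    using r_inv[OF f] l_inv[OF f] by (simp_all add: hom_group_def Neg_def)
  show "Neg C (Neg C f) = f"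
    using inv_inv[OF f] Neg_simps(2,3)[OF assms] unfolding Neg_def by simp
  show "Dom C f = X \<Longrightarrow> Cod C f = Y \<Longrightarrow> Zero C X Y \<boxplus> f = f"
    "Dom C f = X \<Longrightarrow> Cod C f = Y \<Longrightarrow> f \<boxplus> Zero C X Y = f"
    using r_one[OF f] l_one[OF f] by (auto simp: hom_group_def)
qed

lemma Add_assoc:
  assumes "f \<in> Arr C" "g \<in> Arr C" "k \<in> Arr C" "Dom C g = Dom C f" "Cod C g = Cod C f"
    "Dom C k = Dom C f" "Cod C k = Cod C f"
  shows "(f \<boxplus> g) \<boxplus> k = f \<boxplus> (g \<boxplus> k)"
proof -
  interpret comm_group "hom_group C (Dom C f) (Cod C f)" by (rule hom_group_at[OF assms(1)])
  show ?thesis using m_assoc[of f g k] assms by (auto simp: hom_group_def in_Hom)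
qed

lemma Add_right_cancel:
  assumes "f \<boxplus> k = g \<boxplus> k" "f \<in> Arr C" "g \<in> Arr C" "k \<in> Arr C" "Dom C g = Dom C f" "Cod C g = Cod C f"
    "Dom C k = Dom C f" "Cod C k = Cod C f"
  shows "f = g"
proof -
  interpret comm_group "hom_group C (Dom C f) (Cod C f)" by (rule hom_group_at[OF assms(2)])
  show ?thesis using right_cancel[of k f g] assms by (auto simp: hom_group_def in_Hom)
qed

lemma diff_eq_Zero:
  assumes "f \<boxplus> Neg C g = Zero C X Y" "f \<in> Arr C" "g \<in> Arr C"
    "Dom C f = X" "Dom C g = X" "Cod C f = Y" "Cod C g = Y"
  shows "f = g"
  by (rule Add_right_cancel[where k = "Neg C g"]) (use assms in auto)

lemma Neg_unique:
  assumes "f \<boxplus> g = Zero C X Y" "f \<in> Arr C" "g \<in> Arr C"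
    "Dom C f = X" "Dom C g = X" "Cod C f = Y" "Cod C g = Y"
  shows "f = Neg C g"
  by (rule diff_eq_Zero[where X = X and Y = Y]) (use assms in auto)

lemma idem_Zero: "f \<boxplus> f = f \<Longrightarrow> f \<in> Arr C \<Longrightarrow> f = Zero C (Dom C f) (Cod C f)"
  by (rule Add_right_cancel[where k = f]) auto

lemma Comp_Add_right' [simp]:
  "f \<in> Arr C \<Longrightarrow> f' \<in> Arr C \<Longrightarrow> g \<in> Arr C \<Longrightarrow> Dom C f' = Dom C f \<Longrightarrow> Cod C f = Dom C g \<Longrightarrow>
    Cod C f' = Dom C g \<Longrightarrow> g \<cdot> (f \<boxplus> f') = g \<cdot> f \<boxplus> g \<cdot> f'"
  by (rule Comp_Add_right) (auto simp: in_Hom)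

lemma Comp_Add_left' [simp]:
  "f \<in> Arr C \<Longrightarrow> g \<in> Arr C \<Longrightarrow> g' \<in> Arr C \<Longrightarrow> Dom C g = Cod C f \<Longrightarrow> Dom C g' = Cod C f \<Longrightarrow>
    Cod C g' = Cod C g \<Longrightarrow> (g \<boxplus> g') \<cdot> f = g \<cdot> f \<boxplus> g' \<cdot> f"
  by (rule Comp_Add_left) (auto simp: in_Hom)

lemma Comp_Zero [simp]:
  assumes "g \<in> Arr C" "Dom C g = Y" "X \<in> Obj C"
  shows "g \<cdot> Zero C X Y = Zero C X (Cod C g)"
proof -
  have Y: "Y \<in> Obj C" using assms by auto
  have "g \<cdot> (Zero C X Y \<boxplus> Zero C X Y) = g \<cdot> Zero C X Y \<boxplus> g \<cdot> Zero C X Y"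
    using assms Y by (subst Comp_Add_right') auto
  then show ?thesis using idem_Zero[of "g \<cdot> Zero C X Y"] assms Y by simp
qed

lemma Zero_Comp [simp]:
  assumes "f \<in> Arr C" "Cod C f = Y" "Z \<in> Obj C"
  shows "Zero C Y Z \<cdot> f = Zero C (Dom C f) Z"
proof -
  have Y: "Y \<in> Obj C" using assms by auto
  have "(Zero C Y Z \<boxplus> Zero C Y Z) \<cdot> f = Zero C Y Z \<cdot> f \<boxplus> Zero C Y Z \<cdot> f"
    using assms Y by (subst Comp_Add_left') auto
  then show ?thesis using idem_Zero[of "Zero C Y Z \<cdot> f"] assms Y by simp
qed

lemma Neg_Zero [simp]: "X \<in> Obj C \<Longrightarrow> Y \<in> Obj C \<Longrightarrow> Neg C (Zero C X Y) = Zero C X Y"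
  by (rule sym, rule Neg_unique[where X = X and Y = Y]) auto

lemma Comp_Neg [simp]:
  assumes "f \<in> Arr C" "g \<in> Arr C" "Dom C g = Cod C f"
  shows "g \<cdot> Neg C f = Neg C (g \<cdot> f)"
proof (rule Neg_unique[where X = "Dom C f" and Y = "Cod C g"])
  show "g \<cdot> Neg C f \<boxplus> g \<cdot> f = Zero C (Dom C f) (Cod C g)"
    using assms by (subst Comp_Add_right'[symmetric]) auto
qed (use assms in auto)

lemma Neg_Comp [simp]:
  assumes "f \<in> Arr C" "g \<in> Arr C" "Dom C g = Cod C f"
  shows "Neg C g \<cdot> f = Neg C (g \<cdot> f)"
proof (rule Neg_unique[where X = "Dom C f" and Y = "Cod C g"])
  show "Neg C g \<cdot> f \<boxplus> g \<cdot> f = Zero C (Dom C f) (Cod C g)"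
    using assms by (subst Comp_Add_left'[symmetric]) auto
qed (use assms in auto)

lemma Neg_of_Add:
  assumes "f \<in> Arr C" "g \<in> Arr C" "Dom C g = Dom C f" "Cod C g = Cod C f"
  shows "Neg C (f \<boxplus> g) = Neg C f \<boxplus> Neg C g"
proof -
  interpret comm_group "hom_group C (Dom C f) (Cod C f)" by (rule hom_group_at[OF assms(1)])
  show ?thesis
    using inv_mult[of f g] assms by (simp add: hom_group_def in_Hom Neg_def)
qed

lemma is_iso_Neg_Idm [simp]: "X \<in> Obj C \<Longrightarrow> is_iso C X X (Neg C (Idm C X))"
  by (rule is_isoI[where g = "Neg C (Idm C X)"]) auto

lemma biproduct:
  assumes "A \<in> Obj C" "B \<in> Obj C"
  shows "is_biproduct C A B (A \<oplus> B, In1 C A B, In2 C A B, Pr1 C A B, Pr2 C A B)"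
proof -
  have "is_biproduct C A B (biproduct C A B)"
    unfolding biproduct_def by (rule someI_ex) (rule ex_biproduct[OF assms])
  then show ?thesis
    by (auto simp: Biprod_def In1_def In2_def Pr1_def Pr2_def split: prod.splits)
qed

lemma Biprod_simps [simp]:
  assumes "A \<in> Obj C" "B \<in> Obj C"
  shows "A \<oplus> B \<in> Obj C"
    "In1 C A B \<in> Arr C" "Dom C (In1 C A B) = A" "Cod C (In1 C A B) = A \<oplus> B"
    "In2 C A B \<in> Arr C" "Dom C (In2 C A B) = B" "Cod C (In2 C A B) = A \<oplus> B"
    "Pr1 C A B \<in> Arr C" "Dom C (Pr1 C A B) = A \<oplus> B" "Cod C (Pr1 C A B) = A"
    "Pr2 C A B \<in> Arr C" "Dom C (Pr2 C A B) = A \<oplus> B" "Cod C (Pr2 C A B) = B"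
    "Pr1 C A B \<cdot> In1 C A B = Idm C A" "Pr2 C A B \<cdot> In2 C A B = Idm C B"
    "Pr1 C A B \<cdot> In2 C A B = Zero C B A" "Pr2 C A B \<cdot> In1 C A B = Zero C A B"
  using biproduct[OF assms] Cod_Obj[of "In1 C A B"] by (auto simp: is_biproduct_def in_Hom)

lemma Pr_In [simp]:
  assumes "f \<in> Arr C" "A \<in> Obj C" "B \<in> Obj C"
  shows "Cod C f = A \<Longrightarrow> Pr1 C A B \<cdot> (In1 C A B \<cdot> f) = f"
    "Cod C f = A \<Longrightarrow> Pr2 C A B \<cdot> (In1 C A B \<cdot> f) = Zero C (Dom C f) B"
    "Cod C f = B \<Longrightarrow> Pr2 C A B \<cdot> (In2 C A B \<cdot> f) = f"
    "Cod C f = B \<Longrightarrow> Pr1 C A B \<cdot> (In2 C A B \<cdot> f) = Zero C (Dom C f) A"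
  using assms Comp_assoc'[of f "In1 C A B" "Pr1 C A B"] Comp_assoc'[of f "In1 C A B" "Pr2 C A B"]
    Comp_assoc'[of f "In2 C A B" "Pr1 C A B"] Comp_assoc'[of f "In2 C A B" "Pr2 C A B"]
  by (auto simp del: Comp_assoc')

lemma Biprod_id:
  "A \<in> Obj C \<Longrightarrow> B \<in> Obj C \<Longrightarrow>
    In1 C A B \<cdot> Pr1 C A B \<boxplus> In2 C A B \<cdot> Pr2 C A B = Idm C (A \<oplus> B)"
  using biproduct by (auto simp: is_biproduct_def)

lemma into_Biprod_eqI:
  assumes "f \<in> Arr C" "g \<in> Arr C" "Dom C g = Dom C f" "Cod C f = A \<oplus> B" "Cod C g = A \<oplus> B"
    "A \<in> Obj C" "B \<in> Obj C"
    and 1: "Pr1 C A B \<cdot> f = Pr1 C A B \<cdot> g" and 2: "Pr2 C A B \<cdot> f = Pr2 C A B \<cdot> g"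
  shows "f = g"
proof -
  have eq: "k = In1 C A B \<cdot> (Pr1 C A B \<cdot> k) \<boxplus> In2 C A B \<cdot> (Pr2 C A B \<cdot> k)"
    if "k \<in> Arr C" "Cod C k = A \<oplus> B" for k
    using arg_cong[OF Biprod_id, of A B "\<lambda>i. i \<cdot> k"] assms(6,7) that by simp
  show ?thesis
    by (subst eq[of f], simp_all add: assms(1-5) 1 2, rule eq[symmetric]) (use assms in auto)
qed

lemma from_Biprod_eqI:
  assumes "f \<in> Arr C" "g \<in> Arr C" "Cod C g = Cod C f" "Dom C f = A \<oplus> B" "Dom C g = A \<oplus> B"
    "A \<in> Obj C" "B \<in> Obj C"
    and 1: "f \<cdot> In1 C A B = g \<cdot> In1 C A B" and 2: "f \<cdot> In2 C A B = g \<cdot> In2 C A B"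
  shows "f = g"
proof -
  have eq: "k = (k \<cdot> In1 C A B) \<cdot> Pr1 C A B \<boxplus> (k \<cdot> In2 C A B) \<cdot> Pr2 C A B"
    if "k \<in> Arr C" "Dom C k = A \<oplus> B" for k
    using arg_cong[OF Biprod_id, of A B "\<lambda>i. k \<cdot> i"] assms(6,7) that by simp
  show ?thesis
    by (subst eq[of f], simp_all add: assms(1-5) 1 2 del: Comp_assoc', rule eq[symmetric])
      (use assms in auto)
qed

lemma col_simps [simp]:
  assumes "a \<in> Arr C" "b \<in> Arr C" "Dom C b = Dom C a"
  shows "col C a b \<in> Arr C" "Dom C (col C a b) = Dom C a" "Cod C (col C a b) = Cod C a \<oplus> Cod C b"
    "Cod C a = A \<Longrightarrow> Cod C b = B \<Longrightarrow> Pr1 C A B \<cdot> col C a b = a"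
    "Cod C a = A \<Longrightarrow> Cod C b = B \<Longrightarrow> Pr2 C A B \<cdot> col C a b = b"
  using assms by (auto simp: col_def)

lemma row_simps [simp]:
  assumes "a \<in> Arr C" "b \<in> Arr C" "Cod C b = Cod C a"
  shows "row C a b \<in> Arr C" "Cod C (row C a b) = Cod C a" "Dom C (row C a b) = Dom C a \<oplus> Dom C b"
    "Dom C a = A \<Longrightarrow> Dom C b = B \<Longrightarrow> row C a b \<cdot> In1 C A B = a"
    "Dom C a = A \<Longrightarrow> Dom C b = B \<Longrightarrow> row C a b \<cdot> In2 C A B = b"
  using assms by (auto simp: row_def)

lemma Comp_row [simp]:
  assumes "a \<in> Arr C" "b \<in> Arr C" "Cod C b = Cod C a" "k \<in> Arr C" "Dom C k = Cod C a"
  shows "k \<cdot> row C a b = row C (k \<cdot> a) (k \<cdot> b)"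
  using assms by (simp add: row_def)

lemma col_Comp [simp]:
  assumes "a \<in> Arr C" "b \<in> Arr C" "Dom C b = Dom C a" "k \<in> Arr C" "Cod C k = Dom C a"
  shows "col C a b \<cdot> k = col C (a \<cdot> k) (b \<cdot> k)"
  using assms by (simp add: col_def)

lemma row_col [simp]:
  assumes "a \<in> Arr C" "b \<in> Arr C" "Cod C b = Cod C a"
    "c \<in> Arr C" "d \<in> Arr C" "Dom C d = Dom C c" "Cod C c = Dom C a" "Cod C d = Dom C b"
  shows "row C a b \<cdot> col C c d = a \<cdot> c \<boxplus> b \<cdot> d"
  using assms by (simp add: row_def)

lemma row_In [simp]: "A \<in> Obj C \<Longrightarrow> B \<in> Obj C \<Longrightarrow> row C (In1 C A B) (In2 C A B) = Idm C (A \<oplus> B)"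
  by (simp add: row_def Biprod_id)

lemma is_iso_negate_summand:
  "A \<in> Obj C \<Longrightarrow> B \<in> Obj C \<Longrightarrow>
    is_iso C (A \<oplus> B) (A \<oplus> B) (row C (In1 C A B) (Neg C (In2 C A B)))"
  by (rule is_isoI[where g = "row C (In1 C A B) (Neg C (In2 C A B))"]) auto

end

section \<open>Exactness properties of distinguished triangles\<close>

context triangulated_category
begin

lemma Susp_simps [simp]:
  assumes "f \<in> Arr T"
  shows "\<Sigma> f \<in> Arr T" "Dom T (\<Sigma> f) = \<Sigma>\<^sub>o (Dom T f)" "Cod T (\<Sigma> f) = \<Sigma>\<^sub>o (Cod T f)"
  using Susp_Hom[of f "Dom T f" "Cod T f"] assms by (auto simp: in_Hom)

declare SuspO_Obj [simp] Susp_Idm [simp]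

lemma Susp_Comp' [simp]:
  "f \<in> Arr T \<Longrightarrow> g \<in> Arr T \<Longrightarrow> Dom T g = Cod T f \<Longrightarrow> \<Sigma> (g \<cdot> f) = \<Sigma> g \<cdot> \<Sigma> f"
  by (rule Susp_Comp) (auto simp: in_Hom)

lemma Susp_Add' [simp]:
  "f \<in> Arr T \<Longrightarrow> g \<in> Arr T \<Longrightarrow> Dom T g = Dom T f \<Longrightarrow> Cod T g = Cod T f \<Longrightarrow>
    \<Sigma> (f \<boxplus> g) = \<Sigma> f \<boxplus> \<Sigma> g"
  by (rule Susp_Add) (auto simp: in_Hom)

lemma Susp_Zero [simp]:
  assumes "X \<in> Obj T" "Y \<in> Obj T"
  shows "\<Sigma> (Zero T X Y) = Zero T (\<Sigma>\<^sub>o X) (\<Sigma>\<^sub>o Y)"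
  using idem_Zero[of "\<Sigma> (Zero T X Y)"] Susp_Add'[of "Zero T X Y" "Zero T X Y"] assms
  by simp

lemma Susp_Neg [simp]:
  assumes "f \<in> Arr T"
  shows "\<Sigma> (Neg T f) = Neg T (\<Sigma> f)"
proof (rule Neg_unique[where X = "\<Sigma>\<^sub>o (Dom T f)" and Y = "\<Sigma>\<^sub>o (Cod T f)"])
  show "\<Sigma> (Neg T f) \<boxplus> \<Sigma> f = Zero T (\<Sigma>\<^sub>o (Dom T f)) (\<Sigma>\<^sub>o (Cod T f))"
    using assms by (subst Susp_Add'[symmetric]) auto
qed (use assms in auto)

lemma Susp_row_In:
  assumes "a \<in> Arr T" "b \<in> Arr T" "Cod T b = Cod T a" "Dom T a = A" "Dom T b = B"
  shows "\<Sigma> (row T a b) \<cdot> \<Sigma> (In1 T A B) = \<Sigma> a" "\<Sigma> (row T a b) \<cdot> \<Sigma> (In2 T A B) = \<Sigma> b"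
  using Susp_Comp'[of "In1 T A B" "row T a b"] Susp_Comp'[of "In2 T A B" "row T a b"] assms by auto

lemma Susp_full:
  assumes "k \<in> Arr T" "Dom T k = \<Sigma>\<^sub>o X" "Cod T k = \<Sigma>\<^sub>o Y" "X \<in> Obj T" "Y \<in> Obj T"
  obtains l where "l \<in> Arr T" "Dom T l = X" "Cod T l = Y" "k = \<Sigma> l"
proof -
  have "k \<in> \<Sigma> ` Hom T X Y"
    using Susp_fully_faithful[OF assms(4,5)] assms(1-3) by (simp add: bij_betw_def in_Hom)
  then show ?thesis using that by (auto simp: in_Hom)
qed

lemma Susp_faithful:
  assumes "\<Sigma> f = \<Sigma> g" "f \<in> Arr T" "g \<in> Arr T" "Dom T g = Dom T f" "Cod T g = Cod T f"
  shows "f = g"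
  using bij_betw_imp_inj_on[OF Susp_fully_faithful[of "Dom T f" "Cod T f"]] assms
  by (auto simp: in_Hom inj_on_def)

lemma Dist_simps:
  assumes "(X, f, Y, g, Z, h) \<in> \<Delta>"
  shows "f \<in> Arr T" "Dom T f = X" "Cod T f = Y" "g \<in> Arr T" "Dom T g = Y" "Cod T g = Z"
    "h \<in> Arr T" "Dom T h = Z" "Cod T h = \<Sigma>\<^sub>o X" "X \<in> Obj T" "Y \<in> Obj T" "Z \<in> Obj T"
  using Dist_triangle[OF assms] by (auto simp: in_Hom)

lemma rotate:
  assumes "(X, f, Y, g, Z, h) \<in> \<Delta>"
  shows "(Y, g, Z, h, \<Sigma>\<^sub>o X, Neg T (\<Sigma> f)) \<in> \<Delta>"
  using TR2[OF Dist_triangle[OF assms]] assms by simp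

lemma rotate_back:
  assumes "(Y, g, Z, h, \<Sigma>\<^sub>o X, Neg T (\<Sigma> f)) \<in> \<Delta>" "f \<in> Arr T" "Dom T f = X" "Cod T f = Y"
  shows "(X, f, Y, g, Z, h) \<in> \<Delta>"
  by (rule iffD2[OF TR2 assms(1)])
    (use Dist_simps[OF assms(1)] assms(2-4) in \<open>auto simp: in_Hom\<close>)

lemma Dist_iso:
  assumes "(X, f, Y, g, Z, h) \<in> \<Delta>"
    and "is_iso T X X' \<alpha>" "is_iso T Y Y' \<beta>" "is_iso T Z Z' \<gamma>"
    and "f' \<in> Arr T" "Dom T f' = X'" "Cod T f' = Y'" "g' \<in> Arr T" "Dom T g' = Y'" "Cod T g' = Z'"
    "h' \<in> Arr T" "Dom T h' = Z'" "Cod T h' = \<Sigma>\<^sub>o X'"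
    and "\<beta> \<cdot> f = f' \<cdot> \<alpha>" "\<gamma> \<cdot> g = g' \<cdot> \<beta>" "\<Sigma> \<alpha> \<cdot> h = h' \<cdot> \<gamma>"
  shows "(X', f', Y', g', Z', h') \<in> \<Delta>"
  by (rule TR1_iso[OF assms(1) _ _ assms(2-4)])
    (use assms in \<open>auto simp: in_Hom is_iso_def\<close>)

lemma negate_gh:
  assumes "(X, f, Y, g, Z, h) \<in> \<Delta>"
  shows "(X, f, Y, Neg T g, Z, Neg T h) \<in> \<Delta>"
proof -
  note [simp] = Dist_simps[OF assms]
  show ?thesis
    by (rule Dist_iso[OF assms, where \<alpha> = "Idm T X" and \<beta> = "Idm T Y" and \<gamma> = "Neg T (Idm T Z)"]) auto
qed

lemma negate_fg:
  assumes "(X, f, Y, g, Z, h) \<in> \<Delta>"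
  shows "(X, Neg T f, Y, Neg T g, Z, h) \<in> \<Delta>"
proof -
  note [simp] = Dist_simps[OF assms]
  show ?thesis
    by (rule Dist_iso[OF assms, where \<alpha> = "Idm T X" and \<beta> = "Neg T (Idm T Y)" and \<gamma> = "Idm T Z"]) auto
qed

text \<open>
  Three rotations put a sign on each of the three suspended morphisms; the isomorphism that is
  \<open>-1\<close> on \<open>\<Sigma>Y\<close> removes two of them, and the sign of \<open>\<Sigma> h\<close> remains.
\<close>

lemma Dist_Susp:
  assumes "(X, f, Y, g, Z, h) \<in> \<Delta>"
  shows "(\<Sigma>\<^sub>o X, \<Sigma> f, \<Sigma>\<^sub>o Y, \<Sigma> g, \<Sigma>\<^sub>o Z, Neg T (\<Sigma> h)) \<in> \<Delta>"
  using negate_fg[OF rotate[OF rotate[OF rotate[OF assms]]]] Dist_simps[OF assms] by simp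

lemma zero_object_Idm: "is_zero_object T O' \<longleftrightarrow> O' \<in> Obj T \<and> Idm T O' = Zero T O' O'"
proof
  assume O: "is_zero_object T O'"
  then have "O' \<in> Obj T" "\<exists>!f. f \<in> Hom T O' O'" by (auto simp: is_zero_object_def)
  then show "O' \<in> Obj T \<and> Idm T O' = Zero T O' O'" by (auto simp: in_Hom)
next
  assume O: "O' \<in> Obj T \<and> Idm T O' = Zero T O' O'"
  have "f = Zero T X O'" if "f \<in> Hom T X O'" for X f
    using O that Idm_Comp'[of f O'] Zero_Comp[of f O' O'] by (auto simp: in_Hom)
  moreover have "f = Zero T O' X" if "f \<in> Hom T O' X" for X f
    using O that Comp_Idm'[of f O'] Comp_Zero[of f O' O'] by (auto simp: in_Hom)
  ultimately show "is_zero_object T O'"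
    using O unfolding is_zero_object_def by (metis Zero_simps in_Hom)
qed

text \<open>
  This is a rotation backwards of the triangle on the identity of \<open>W\<close>, which needs \<open>\<Sigma>\<close> of a zero
  object to be a zero object.
\<close>

lemma trivial_Dist:
  assumes "is_zero_object T O'" "W \<in> Obj T"
  shows "(O', Zero T O' W, W, Idm T W, W, Zero T W (\<Sigma>\<^sub>o O')) \<in> \<Delta>"
proof (rule rotate_back)
  have O: "O' \<in> Obj T" using assms by (simp add: zero_object_Idm)
  have "is_zero_object T (\<Sigma>\<^sub>o O')"
    using assms(1) Susp_Idm[of O'] Susp_Zero[of O' O'] by (auto simp: zero_object_Idm simp del: Susp_Idm)
  from TR1_id[OF assms(2) this]
  show "(W, Idm T W, W, Zero T W (\<Sigma>\<^sub>o O'), \<Sigma>\<^sub>o O', Neg T (\<Sigma> (Zero T O' W))) \<in> \<Delta>"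
    using O assms(2) by simp
qed (use assms in \<open>auto simp: zero_object_Idm\<close>)

lemma Dist_gf:
  assumes "(X, f, Y, g, Z, h) \<in> \<Delta>"
  shows "g \<cdot> f = Zero T X Z"
proof -
  note [simp] = Dist_simps[OF assms]
  obtain O' where O: "is_zero_object T O'" using ex_zero_object by blast
  then have [simp]: "O' \<in> Obj T" by (simp add: zero_object_Idm)
  obtain \<gamma> where "triangle_morphism T (X, Idm T X, X, Zero T X O', O', Zero T O' (\<Sigma>\<^sub>o X))
    (X, f, Y, g, Z, h) (Idm T X, f, \<gamma>)"
    using TR3[OF TR1_id[OF _ O] assms, of X "Idm T X" f] by (auto simp: in_Hom)
  then show ?thesis by (auto simp: in_Hom)
qed

lemma Dist_hg: "(X, f, Y, g, Z, h) \<in> \<Delta> \<Longrightarrow> h \<cdot> g = Zero T Y (\<Sigma>\<^sub>o X)"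
  by (rule Dist_gf[OF rotate])

text \<open>
  A morphism \<open>k\<close> on \<open>Y\<close> with \<open>k \<cdot> f = 0\<close> is the middle part of a morphism from the triangle to
  \<open>0 \<rightarrow> W \<rightarrow> W \<rightarrow> \<Sigma>0\<close>, and its third component is the factorisation.  For the dual statement the
  third component lies between suspensions, so fullness and faithfulness of \<open>\<Sigma>\<close> are needed.
\<close>

lemma Dist_weak_cokernel:
  assumes "(X, f, Y, g, Z, h) \<in> \<Delta>" "k \<in> Arr T" "Dom T k = Y" "k \<cdot> f = Zero T X W" "Cod T k = W"
  obtains l where "l \<in> Arr T" "Dom T l = Z" "Cod T l = W" "k = l \<cdot> g"
proof -
  note [simp] = Dist_simps[OF assms(1)] assms(2-5)
  have W [simp]: "W \<in> Obj T" using Cod_Obj[OF assms(2)] by simp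
  obtain O' where O: "is_zero_object T O'" using ex_zero_object by blast
  then have [simp]: "O' \<in> Obj T" by (simp add: zero_object_Idm)
  obtain l where "triangle_morphism T (X, f, Y, g, Z, h)
      (O', Zero T O' W, W, Idm T W, W, Zero T W (\<Sigma>\<^sub>o O')) (Zero T X O', k, l)"
    using TR3[OF assms(1) trivial_Dist[OF O W], of "Zero T X O'" k] by (auto simp: in_Hom)
  then show ?thesis using that by (auto simp: in_Hom)
qed

lemma Dist_weak_kernel:
  assumes "(X, f, Y, g, Z, h) \<in> \<Delta>" "k \<in> Arr T" "Cod T k = Y" "g \<cdot> k = Zero T W Z" "Dom T k = W"
  obtains l where "l \<in> Arr T" "Dom T l = W" "Cod T l = X" "k = f \<cdot> l"
proof -
  note [simp] = Dist_simps[OF assms(1)] assms(2-5)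
  have W [simp]: "W \<in> Obj T" using Dom_Obj[OF assms(2)] by simp
  obtain O' where O: "is_zero_object T O'" using ex_zero_object by blast
  then have [simp]: "O' \<in> Obj T" by (simp add: zero_object_Idm)
  obtain l' where l': "triangle_morphism T (W, Zero T W O', O', Zero T O' (\<Sigma>\<^sub>o W), \<Sigma>\<^sub>o W, Neg T (Idm T (\<Sigma>\<^sub>o W)))
      (Y, g, Z, h, \<Sigma>\<^sub>o X, Neg T (\<Sigma> f)) (k, Zero T O' Z, l')"
    using TR3[OF rotate[OF TR1_id[OF W O]] rotate[OF assms(1)], of k "Zero T O' Z"]
    by (auto simp: in_Hom)
  then have [simp]: "l' \<in> Arr T" "Dom T l' = \<Sigma>\<^sub>o W" "Cod T l' = \<Sigma>\<^sub>o X" by (auto simp: in_Hom)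
  obtain l where l [simp]: "l \<in> Arr T" "Dom T l = W" "Cod T l = X" "l' = \<Sigma> l"
    by (rule Susp_full[of l' W X]) auto
  have "Neg T (\<Sigma> k) = Neg T (\<Sigma> (f \<cdot> l))" using l' by auto
  then have "\<Sigma> k = \<Sigma> (f \<cdot> l)"
    using Neg_Neg[of "\<Sigma> k"] Neg_Neg[of "\<Sigma> (f \<cdot> l)"] by (simp del: Neg_Neg)
  then have "k = f \<cdot> l" by (rule Susp_faithful) auto
  then show ?thesis using that l by blast
qed

text \<open>
  The cone \<open>K\<close> of \<open>In1\<close> maps to \<open>D\<close> because \<open>Pr2 \<cdot> In1 = 0\<close>.  The inverse is \<open>k \<cdot> In2\<close>; one of the two
  composites is the identity only because \<open>k\<close> can be cancelled.
\<close>

lemma Biprod_Dist: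
  assumes [simp]: "B \<in> Obj T" "D \<in> Obj T"
  shows "(B, In1 T B D, B \<oplus> D, Pr2 T B D, D, Zero T D (\<Sigma>\<^sub>o B)) \<in> \<Delta>"
proof -
  obtain K k d where K: "(B, In1 T B D, B \<oplus> D, k, K, d) \<in> \<Delta>"
    using TR1_ex[of "In1 T B D" B "B \<oplus> D"] by (auto simp: in_Hom)
  note [simp] = Dist_simps[OF K]
  have ki: "k \<cdot> In1 T B D = Zero T B K" by (rule Dist_gf[OF K])
  obtain l where [simp]: "l \<in> Arr T" "Dom T l = K" "Cod T l = D" and l: "Pr2 T B D = l \<cdot> k"
    by (rule Dist_weak_cokernel[OF K, of "Pr2 T B D" D]) auto
  \<comment> \<open>\<open>\<Sigma> In1\<close> is a split monomorphism, so the connecting morphism vanishes.\<close>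
  have "\<Sigma> (In1 T B D) \<cdot> d = Zero T K (\<Sigma>\<^sub>o (B \<oplus> D))"
    using Dist_hg[OF rotate[OF K]] Neg_Neg[of "\<Sigma> (In1 T B D) \<cdot> d"] by (simp del: Neg_Neg)
  then have "\<Sigma> (Pr1 T B D) \<cdot> (\<Sigma> (In1 T B D) \<cdot> d) = Zero T K (\<Sigma>\<^sub>o B)" by simp
  then have d: "d = Zero T K (\<Sigma>\<^sub>o B)"
    using Comp_assoc'[of d "\<Sigma> (In1 T B D)" "\<Sigma> (Pr1 T B D)"]
      Susp_Comp'[of "In1 T B D" "Pr1 T B D", symmetric] by (simp del: Comp_assoc' Susp_Comp')
  \<comment> \<open>Hence \<open>k\<close> is an epimorphism: whatever is killed by \<open>k\<close> factors through \<open>d = 0\<close>.\<close>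
  have "k \<cdot> (In2 T B D \<cdot> l) \<cdot> k = k"
    by (rule from_Biprod_eqI[where A = B and B = D]) (simp_all add: ki l[symmetric])
  then have "(k \<cdot> In2 T B D \<cdot> l \<boxplus> Neg T (Idm T K)) \<cdot> k = Zero T (B \<oplus> D) K"
    by simp
  then obtain m where [simp]: "m \<in> Arr T" "Dom T m = \<Sigma>\<^sub>o B" "Cod T m = K"
    and m: "k \<cdot> In2 T B D \<cdot> l \<boxplus> Neg T (Idm T K) = m \<cdot> d"
    by (rule Dist_weak_cokernel[OF rotate[OF K], rotated 2]) auto
  have 1: "k \<cdot> In2 T B D \<cdot> l = Idm T K"
    by (rule diff_eq_Zero[where X = K and Y = K]) (use m d in auto)
  have 2: "l \<cdot> k \<cdot> In2 T B D = Idm T D"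
    using Comp_assoc'[of "In2 T B D" k l] by (simp del: Comp_assoc' add: l[symmetric])
  have "is_iso T K D l"
    by (rule is_isoI[where g = "k \<cdot> In2 T B D"]) (use 1 2 in auto)
  then show ?thesis
    by (intro Dist_iso[OF K, where \<alpha> = "Idm T B" and \<beta> = "Idm T (B \<oplus> D)" and \<gamma> = l])
      (auto simp: l d)
qed

text \<open>
  The vanishing of the connecting morphism alone gives \<open>r\<close> and \<open>\<sigma>\<close>; that no morphism \<open>B \<rightarrow> A\<close> is
  nonzero makes them fit together without correcting \<open>\<sigma>\<close>.
\<close>

lemma Dist_split:
  assumes tri: "(A, a, W, b, B, Zero T B (\<Sigma>\<^sub>o A)) \<in> \<Delta>"
    and vanish: "Hom T B A = {Zero T B A}"
  obtains r \<sigma> where "r \<in> Arr T" "Dom T r = W" "Cod T r = A" "\<sigma> \<in> Arr T" "Dom T \<sigma> = B" "Cod T \<sigma> = W"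
    "r \<cdot> a = Idm T A" "b \<cdot> \<sigma> = Idm T B" "r \<cdot> \<sigma> = Zero T B A" "a \<cdot> r \<boxplus> \<sigma> \<cdot> b = Idm T W"
proof -
  note [simp] = Dist_simps[OF tri]
  have ba: "b \<cdot> a = Zero T A B" by (rule Dist_gf[OF tri])
  obtain r' where [simp]: "r' \<in> Arr T" "Dom T r' = \<Sigma>\<^sub>o W" "Cod T r' = \<Sigma>\<^sub>o A"
    and r': "Idm T (\<Sigma>\<^sub>o A) = r' \<cdot> Neg T (\<Sigma> a)"
    by (rule Dist_weak_cokernel[OF rotate[OF rotate[OF tri]], of "Idm T (\<Sigma>\<^sub>o A)"]) auto
  obtain r'' where [simp]: "r'' \<in> Arr T" "Dom T r'' = W" "Cod T r'' = A" "r' = \<Sigma> r''"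
    by (rule Susp_full[of r' W A]) auto
  define r where "r = Neg T r''"
  have [simp]: "r \<in> Arr T" "Dom T r = W" "Cod T r = A" by (auto simp: r_def)
  have ra: "r \<cdot> a = Idm T A"
    by (rule Susp_faithful) (use r' in \<open>auto simp: r_def\<close>)
  obtain \<sigma> where [simp]: "\<sigma> \<in> Arr T" "Dom T \<sigma> = B" "Cod T \<sigma> = W" and b\<sigma>: "b \<cdot> \<sigma> = Idm T B"
    by (rule Dist_weak_kernel[OF rotate[OF tri], of "Idm T B" B]) auto
  have "r \<cdot> \<sigma> \<in> Hom T B A" by (simp add: in_Hom)
  then have r\<sigma>: "r \<cdot> \<sigma> = Zero T B A" using vanish by simp
  let ?e = "(a \<cdot> r \<boxplus> \<sigma> \<cdot> b) \<boxplus> Neg T (Idm T W)"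
  \<comment> \<open>\<open>?e\<close> is killed by \<open>b\<close>, hence is \<open>a \<cdot> k\<close>, and \<open>k = r \<cdot> a \<cdot> k = r \<cdot> ?e = 0\<close>.\<close>
  have "b \<cdot> ?e = Zero T W B" by (simp add: Comp_left[OF ba] Comp_left[OF b\<sigma>])
  then obtain k where [simp]: "k \<in> Arr T" "Dom T k = W" "Cod T k = A" and k: "?e = a \<cdot> k"
    by (rule Dist_weak_kernel[OF tri, rotated 2]) auto
  have "k = r \<cdot> (a \<cdot> k)" by (simp add: Comp_left[OF ra])
  also have "\<dots> = Zero T W A"
    unfolding k[symmetric] by (simp add: Comp_left[OF ra] Comp_left[OF r\<sigma>])
  finally have "?e = Zero T W W" using k by simp
  then have "a \<cdot> r \<boxplus> \<sigma> \<cdot> b = Idm T W" by (rule diff_eq_Zero) auto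
  then show ?thesis using that[of r \<sigma>] ra b\<sigma> r\<sigma> by simp
qed

section \<open>Homotopy cartesian squares and their cones\<close>

text \<open>
  The octahedral axiom is applied to \<open>Pr2 \<cdot> (k, l) = l\<close>, where \<open>Pr2\<close> has cone \<open>\<Sigma>B\<close> and \<open>(k, l)\<close> has
  cone \<open>E\<close>.  It gives a triangle \<open>E \<rightarrow> K \<rightarrow> \<Sigma>B \<rightarrow> \<Sigma>E\<close> with last morphism \<open>-\<Sigma> m\<close>, so one rotation
  backwards shows that \<open>m\<close>, the side parallel to \<open>l\<close>, has the same cone \<open>K\<close> as \<open>l\<close>.
\<close>

lemma homotopy_square_cone:
  assumes sq: "(A, col T k l, B \<oplus> D, row T m n, E, d) \<in> \<Delta>"
    and cone: "(A, l, D, c', K, c'') \<in> \<Delta>"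
    and "k \<in> Hom T A B" "m \<in> Hom T B E" "n \<in> Hom T D E"
  obtains a where "(B, m, E, a, K, Neg T (\<Sigma> k \<cdot> c'')) \<in> \<Delta>" "a \<cdot> n = c'" "c'' \<cdot> a = d"
proof -
  note [simp] = Dist_simps[OF sq] Dist_simps[OF cone]
  have [simp]: "k \<in> Arr T" "Dom T k = A" "Cod T k = B" "m \<in> Arr T" "Dom T m = B" "Cod T m = E"
    "n \<in> Arr T" "Dom T n = D" "Cod T n = E"
    using assms(3-5) by (auto simp: in_Hom)
  have [simp]: "B \<in> Obj T" "D \<in> Obj T"
    using Cod_Obj[of k] Dom_Obj[of n] by auto
  have "(A, Pr2 T B D \<cdot> col T k l, D, c', K, c'') \<in> \<Delta>" using cone by simp
  from TR4[OF sq rotate[OF Biprod_Dist] this]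
  obtain a b where ab: "(E, a, K, b, \<Sigma>\<^sub>o B, \<Sigma> (row T m n) \<cdot> Neg T (\<Sigma> (In1 T B D))) \<in> \<Delta>"
    and a: "a \<cdot> row T m n = c' \<cdot> Pr2 T B D" "c'' \<cdot> a = d"
    and b: "Neg T (\<Sigma> (In1 T B D)) \<cdot> b = \<Sigma> (col T k l) \<cdot> c''"
    by auto
  note [simp] = Dist_simps[OF ab]
  have "\<Sigma> (Pr1 T B D \<cdot> Neg T (In1 T B D)) \<cdot> b = \<Sigma> (Pr1 T B D \<cdot> col T k l) \<cdot> c''"
    using arg_cong[OF b, of "\<lambda>x. \<Sigma> (Pr1 T B D) \<cdot> x"] by
      (simp del: Comp_Neg Neg_Comp col_simps Biprod_simps(14))
  then have "Neg T b = \<Sigma> k \<cdot> c''" by simp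
  then have b: "b = Neg T (\<Sigma> k \<cdot> c'')" using Neg_Neg[of b] by simp
  have m: "\<Sigma> (row T m n) \<cdot> Neg T (\<Sigma> (In1 T B D)) = Neg T (\<Sigma> m)"
    by (simp add: Susp_row_In)
  have "(B, m, E, a, K, b) \<in> \<Delta>"
    by (rule rotate_back) (use ab m in auto)
  moreover have "a \<cdot> n = c'"
    using arg_cong[OF a(1), of "\<lambda>x. x \<cdot> In2 T B D"] by simp
  ultimately show ?thesis using that a(2) b by blast
qed

section \<open>Homotopic morphisms are middling good\<close>

lemma homotopic_imp_middling_good:
  assumes row1: "(X, f, Y, g, Z, h) \<in> \<Delta>" and row2: "(X', f', Y', g', Z', h') \<in> \<Delta>"
    and mor: "triangle_morphism T (X, f, Y, g, Z, h) (X', f', Y', g', Z', h') (\<alpha>, \<beta>, \<gamma>)"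
    and hom: "homotopic T (X, f, Y, g, Z, h) (X', f', Y', g', Z', h') (\<alpha>, \<beta>, \<gamma>)"
  shows "middling_good T (X, f, Y, g, Z, h) (X', f', Y', g', Z', h') (\<alpha>, \<beta>, \<gamma>)"
proof -
  obtain E s t \<eta> \<beta>\<^sub>1 \<beta>\<^sub>2 where
    mid: "(X', s, E, t, Z, \<eta>) \<in> \<Delta>" and \<beta>: "\<beta> = \<beta>\<^sub>2 \<cdot> \<beta>\<^sub>1" and
    m1: "triangle_morphism T (X, f, Y, g, Z, h) (X', s, E, t, Z, \<eta>) (\<alpha>, \<beta>\<^sub>1, Idm T Z)" and
    m2: "triangle_morphism T (X', s, E, t, Z, \<eta>) (X', f', Y', g', Z', h') (Idm T X', \<beta>\<^sub>2, \<gamma>)" and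
    po: "(X, col T f \<alpha>, Y \<oplus> X', row T \<beta>\<^sub>1 (Neg T s), E, h \<cdot> t) \<in> \<Delta>" and
    pb: "(E, col T (Neg T t) \<beta>\<^sub>2, Z \<oplus> Y', row T \<gamma> g', Z', \<Sigma> s \<cdot> h') \<in> \<Delta>"
    using hom by auto
  note [simp] = Dist_simps[OF row1] Dist_simps[OF row2] Dist_simps[OF mid]
  have [simp]: "\<alpha> \<in> Arr T" "Dom T \<alpha> = X" "Cod T \<alpha> = X'" "\<gamma> \<in> Arr T" "Dom T \<gamma> = Z" "Cod T \<gamma> = Z'"
    "\<beta>\<^sub>1 \<in> Arr T" "Dom T \<beta>\<^sub>1 = Y" "Cod T \<beta>\<^sub>1 = E" "\<beta>\<^sub>2 \<in> Arr T" "Dom T \<beta>\<^sub>2 = E" "Cod T \<beta>\<^sub>2 = Y'"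
    using m1 m2 by (auto simp: in_Hom)
  have t\<beta>\<^sub>1: "t \<cdot> \<beta>\<^sub>1 = g" and \<beta>\<^sub>2s: "\<beta>\<^sub>2 \<cdot> s = f'"
    using m1 m2 by (auto simp: in_Hom)
  obtain X'' \<alpha>' \<alpha>'' where col1: "(X, \<alpha>, X', \<alpha>', X'', \<alpha>'') \<in> \<Delta>"
    using TR1_ex[of \<alpha> X X'] by (auto simp: in_Hom)
  obtain Y'' \<beta>' \<beta>'' where col2: "(Y, \<beta>, Y', \<beta>', Y'', \<beta>'') \<in> \<Delta>"
    using TR1_ex[of \<beta> Y Y'] by (auto simp: in_Hom \<beta>)
  obtain Z'' p' q' where cone2: "(E, \<beta>\<^sub>2, Y', p', Z'', q') \<in> \<Delta>"
    using TR1_ex[of \<beta>\<^sub>2 E Y'] by (auto simp: in_Hom)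
  note [simp] = Dist_simps[OF col1] Dist_simps[OF col2] Dist_simps[OF cone2]
  obtain a where a: "(Y, \<beta>\<^sub>1, E, a, X'', Neg T (\<Sigma> f \<cdot> \<alpha>'')) \<in> \<Delta>" "a \<cdot> Neg T s = \<alpha>'" "\<alpha>'' \<cdot> a = h \<cdot> t"
    by (rule homotopy_square_cone[OF po col1]) (auto simp: in_Hom)
  note [simp] = Dist_simps[OF a(1)]
  \<comment> \<open>The square carries \<open>-s\<close> instead of \<open>s\<close>, so the comparison map has to change sign.  This sign is
    the one of the anticommuting square.\<close>
  define p where "p = Neg T a"
  have cone1: "(Y, \<beta>\<^sub>1, E, p, X'', \<Sigma> f \<cdot> \<alpha>'') \<in> \<Delta>"
    using negate_gh[OF a(1)] by (simp add: p_def)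
  note [simp] = Dist_simps[OF cone1]
  have ps: "p \<cdot> s = \<alpha>'" and \<alpha>''p: "\<alpha>'' \<cdot> p = Neg T (h \<cdot> t)"
    using a(2,3) by (auto simp: p_def)
  obtain \<gamma>' where \<gamma>': "(Z, \<gamma>, Z', \<gamma>', Z'', Neg T (\<Sigma> (Neg T t) \<cdot> q')) \<in> \<Delta>"
      "\<gamma>' \<cdot> g' = p'" "q' \<cdot> \<gamma>' = \<Sigma> s \<cdot> h'"
    by (rule homotopy_square_cone[OF pb cone2]) (auto simp: in_Hom)
  then have col3: "(Z, \<gamma>, Z', \<gamma>', Z'', \<Sigma> t \<cdot> q') \<in> \<Delta>" by simp
  note [simp] = Dist_simps[OF col3]
  \<comment> \<open>\<open>X''\<close>, \<open>Y''\<close> and \<open>Z''\<close> are now cones of \<open>\<beta>\<^sub>1\<close>, \<open>\<beta>\<^sub>2 \<cdot> \<beta>\<^sub>1\<close> and \<open>\<beta>\<^sub>2\<close>.\<close>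
  obtain f'' g'' where row3: "(X'', f'', Y'', g'', Z'', \<Sigma> p \<cdot> q') \<in> \<Delta>"
    and oct: "f'' \<cdot> p = \<beta>' \<cdot> \<beta>\<^sub>2" "\<beta>'' \<cdot> f'' = \<Sigma> f \<cdot> \<alpha>''" "g'' \<cdot> \<beta>' = p'" "q' \<cdot> g'' = \<Sigma> \<beta>\<^sub>1 \<cdot> \<beta>''"
    using TR4[OF cone1 cone2 col2[unfolded \<beta>]] by auto
  note [simp] = Dist_simps[OF row3]
  have 1: "\<beta>' \<cdot> f' = f'' \<cdot> \<alpha>'"
  proof -
    have "f'' \<cdot> \<alpha>' = (f'' \<cdot> p) \<cdot> s" by (simp add: ps)
    also have "\<dots> = \<beta>' \<cdot> f'" by (simp add: oct \<beta>\<^sub>2s)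
    finally show ?thesis ..
  qed
  have 2: "\<gamma>' \<cdot> g' = g'' \<cdot> \<beta>'" by (simp add: \<gamma>' oct)
  have 3: "\<Sigma> \<alpha>' \<cdot> h' = (\<Sigma> p \<cdot> q') \<cdot> \<gamma>'"
    by (simp add: \<gamma>' ps[symmetric])
  have 4: "(\<Sigma> t \<cdot> q') \<cdot> g'' = \<Sigma> g \<cdot> \<beta>''"
    by (simp add: oct t\<beta>\<^sub>1[symmetric])
  have 5: "\<Sigma> \<alpha>'' \<cdot> (\<Sigma> p \<cdot> q') = Neg T (\<Sigma> h \<cdot> (\<Sigma> t \<cdot> q'))"
  proof -
    have "\<Sigma> \<alpha>'' \<cdot> (\<Sigma> p \<cdot> q') = \<Sigma> (\<alpha>'' \<cdot> p) \<cdot> q'" by simp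
    also have "\<dots> = Neg T (\<Sigma> h \<cdot> (\<Sigma> t \<cdot> q'))" by (simp only: \<alpha>''p) simp
    finally show ?thesis .
  qed
  show ?thesis
    unfolding middling_good.simps
    by (rule exI[of _ X''], rule exI[of _ Y''], rule exI[of _ Z''], rule exI[of _ f''],
        rule exI[of _ g''], rule exI[of _ "\<Sigma> p \<cdot> q'"], rule exI[of _ \<alpha>'], rule exI[of _ \<alpha>''],
        rule exI[of _ \<beta>'], rule exI[of _ \<beta>''], rule exI[of _ \<gamma>'], rule exI[of _ "\<Sigma> t \<cdot> q'"])
      (intro conjI row1 row2 row3 Dist_Susp[OF row1] col1 col2 col3 Dist_Susp[OF col1]
        1 2 3 oct(2) 4 5; use mor in simp)
qed

section \<open>Homotopic morphisms that are good\<close>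

lemma homotopic_imp_good:
  assumes row1: "(X, f, Y, g, Z, h) \<in> \<Delta>" and row2: "(X', f', Y', g', Z', h') \<in> \<Delta>"
    and hom: "homotopic T (X, f, Y, g, Z, h) (X', f', Y', g', Z', h') (\<alpha>, \<beta>, \<gamma>)"
    and vanish: "Hom T Z' (\<Sigma>\<^sub>o X) = {Zero T Z' (\<Sigma>\<^sub>o X)}"
  shows "good T (X, f, Y, g, Z, h) (X', f', Y', g', Z', h') (\<alpha>, \<beta>, \<gamma>)"
proof -
  obtain E s t \<eta> \<beta>\<^sub>1 \<beta>\<^sub>2 where
    mid: "(X', s, E, t, Z, \<eta>) \<in> \<Delta>" and \<beta>: "\<beta> = \<beta>\<^sub>2 \<cdot> \<beta>\<^sub>1" and
    m1: "triangle_morphism T (X, f, Y, g, Z, h) (X', s, E, t, Z, \<eta>) (\<alpha>, \<beta>\<^sub>1, Idm T Z)" and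
    m2: "triangle_morphism T (X', s, E, t, Z, \<eta>) (X', f', Y', g', Z', h') (Idm T X', \<beta>\<^sub>2, \<gamma>)" and
    po: "(X, col T f \<alpha>, Y \<oplus> X', row T \<beta>\<^sub>1 (Neg T s), E, h \<cdot> t) \<in> \<Delta>" and
    pb: "(E, col T (Neg T t) \<beta>\<^sub>2, Z \<oplus> Y', row T \<gamma> g', Z', \<Sigma> s \<cdot> h') \<in> \<Delta>"
    using hom by auto
  note [simp] = Dist_simps[OF row1] Dist_simps[OF row2] Dist_simps[OF mid]
  have [simp]: "\<alpha> \<in> Arr T" "Dom T \<alpha> = X" "Cod T \<alpha> = X'" "\<gamma> \<in> Arr T" "Dom T \<gamma> = Z" "Cod T \<gamma> = Z'"
    "\<beta>\<^sub>1 \<in> Arr T" "Dom T \<beta>\<^sub>1 = Y" "Cod T \<beta>\<^sub>1 = E" "\<beta>\<^sub>2 \<in> Arr T" "Dom T \<beta>\<^sub>2 = E" "Cod T \<beta>\<^sub>2 = Y'"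
    using m1 m2 by (auto simp: in_Hom)
  have t\<beta>\<^sub>1: "t \<cdot> \<beta>\<^sub>1 = g" and \<beta>\<^sub>2s: "\<beta>\<^sub>2 \<cdot> s = f'" and ts: "t \<cdot> s = Zero T X' Z"
    using m1 m2 Dist_gf[OF mid] by (auto simp: in_Hom)
  have vanish': "k = Zero T Z' (\<Sigma>\<^sub>o X)" if "k \<in> Arr T" "Dom T k = Z'" "Cod T k = \<Sigma>\<^sub>o X" for k
  proof -
    have "k \<in> Hom T Z' (\<Sigma>\<^sub>o X)" using that by (simp add: in_Hom)
    then show ?thesis unfolding vanish by simp
  qed
  \<comment> \<open>The mapping cone contains \<open>f' = \<beta>\<^sub>2 \<cdot> s\<close> with a plus sign, so the sign of \<open>s\<close> is moved to \<open>\<alpha>\<close>.\<close>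
  have po': "(X, col T f (Neg T \<alpha>), Y \<oplus> X', row T \<beta>\<^sub>1 s, E, h \<cdot> t) \<in> \<Delta>"
    by (rule Dist_iso[OF po is_iso_Idm is_iso_negate_summand is_iso_Idm])
      (auto simp: col_def[of _ f "Neg T \<alpha>"])
  define \<phi> where "\<phi> = mat T (Neg T g) (Zero T X' Z) \<beta> f'"
  have \<phi>: "col T (Neg T t) \<beta>\<^sub>2 \<cdot> row T \<beta>\<^sub>1 s = \<phi>"
    by (rule into_Biprod_eqI[where A = Z and B = Y'])
      (auto simp: \<phi>_def mat_def \<beta> t\<beta>\<^sub>1 \<beta>\<^sub>2s ts)
  have [simp]: "\<phi> \<in> Arr T" "Dom T \<phi> = Y \<oplus> X'" "Cod T \<phi> = Z \<oplus> Y'"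
    by (auto simp: \<phi>_def mat_def \<beta>)
  obtain W w' w'' where W: "(Y \<oplus> X', \<phi>, Z \<oplus> Y', w', W, w'') \<in> \<Delta>"
    using TR1_ex[of \<phi> "Y \<oplus> X'" "Z \<oplus> Y'"] by (auto simp: in_Hom)
  note [simp] = Dist_simps[OF W]
  obtain a b where ab: "(\<Sigma>\<^sub>o X, a, W, b, Z', \<Sigma> (h \<cdot> t) \<cdot> (\<Sigma> s \<cdot> h')) \<in> \<Delta>"
    and a: "a \<cdot> (h \<cdot> t) = w' \<cdot> col T (Neg T t) \<beta>\<^sub>2" "w'' \<cdot> a = Neg T (\<Sigma> (col T f (Neg T \<alpha>)))"
    and b: "b \<cdot> w' = row T \<gamma> g'" "(\<Sigma> s \<cdot> h') \<cdot> b = \<Sigma> (row T \<beta>\<^sub>1 s) \<cdot> w''"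
    using TR4[OF rotate[OF po'] pb W[folded \<phi>]] by auto
  note [simp] = Dist_simps[OF ab]
  have "\<Sigma> (h \<cdot> t) \<cdot> (\<Sigma> s \<cdot> h') = \<Sigma> (h \<cdot> (t \<cdot> s)) \<cdot> h'" by simp
  also have "\<dots> = Zero T Z' (\<Sigma>\<^sub>o (\<Sigma>\<^sub>o X))" by (simp only: ts) simp
  finally have ab0: "(\<Sigma>\<^sub>o X, a, W, b, Z', Zero T Z' (\<Sigma>\<^sub>o (\<Sigma>\<^sub>o X))) \<in> \<Delta>" using ab by simp
  have ba: "b \<cdot> a = Zero T (\<Sigma>\<^sub>o X) Z'" by (rule Dist_gf[OF ab0])
  obtain r \<sigma> where [simp]: "r \<in> Arr T" "Dom T r = W" "Cod T r = \<Sigma>\<^sub>o X"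
      "\<sigma> \<in> Arr T" "Dom T \<sigma> = Z'" "Cod T \<sigma> = W"
    and ra: "r \<cdot> a = Idm T (\<Sigma>\<^sub>o X)" and b\<sigma>: "b \<cdot> \<sigma> = Idm T Z'"
    and r\<sigma>: "r \<cdot> \<sigma> = Zero T Z' (\<Sigma>\<^sub>o X)" and split: "a \<cdot> r \<boxplus> \<sigma> \<cdot> b = Idm T W"
    by (rule Dist_split[OF ab0 vanish])
  have \<theta>: "is_iso T W (\<Sigma>\<^sub>o X \<oplus> Z') (col T r b)"
    by (rule is_isoI[where g = "row T a \<sigma>"])
      (auto simp: split ra ba r\<sigma> b\<sigma> col_def[of _ "Idm T _"] col_def[of _ "Zero T _ _"])
  \<comment> \<open>Both sides agree after composing with \<open>(-t, \<beta>\<^sub>2)\<close>, so their difference factors through a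
    morphism \<open>Z' \<rightarrow> \<Sigma>X\<close>.\<close>
  have rw': "r \<cdot> w' = row T (Neg T h) (Zero T Y' (\<Sigma>\<^sub>o X))"
  proof -
    let ?e = "r \<cdot> w' \<boxplus> Neg T (row T (Neg T h) (Zero T Y' (\<Sigma>\<^sub>o X)))"
    have "r \<cdot> (w' \<cdot> col T (Neg T t) \<beta>\<^sub>2) = h \<cdot> t"
      unfolding a(1)[symmetric] using Comp_assoc'[of "h \<cdot> t" a r] by (simp add: ra del: Comp_assoc')
    then have "?e \<cdot> col T (Neg T t) \<beta>\<^sub>2 = Zero T E (\<Sigma>\<^sub>o X)" by simp
    then obtain k where [simp]: "k \<in> Arr T" "Dom T k = Z'" "Cod T k = \<Sigma>\<^sub>o X"
      and k: "?e = k \<cdot> row T \<gamma> g'"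
      by (rule Dist_weak_cokernel[OF pb, rotated 2]) auto
    have "k = Zero T Z' (\<Sigma>\<^sub>o X)" by (rule vanish') auto
    then have "?e = Zero T (Z \<oplus> Y') (\<Sigma>\<^sub>o X)" using k by (simp del: Comp_row)
    then show ?thesis by (rule diff_eq_Zero) auto
  qed
  \<comment> \<open>Both sides agree after composing with \<open>\<Sigma>(\<beta>\<^sub>1, s)\<close>; the kernel of this comes from \<open>\<Sigma>X\<close>, so again
    their difference factors through a morphism \<open>Z' \<rightarrow> \<Sigma>X\<close>.\<close>
  have w''\<sigma>: "w'' \<cdot> \<sigma> = \<Sigma> (In2 T Y X') \<cdot> h'"
  proof -
    let ?e = "w'' \<cdot> \<sigma> \<boxplus> Neg T (\<Sigma> (In2 T Y X') \<cdot> h')"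
    have 1: "\<Sigma> (row T \<beta>\<^sub>1 s) \<cdot> (w'' \<cdot> \<sigma>) = \<Sigma> s \<cdot> h'"
      using arg_cong[OF b(2), of "\<lambda>x. x \<cdot> \<sigma>"] by (simp add: b\<sigma>)
    have 2: "\<Sigma> (row T \<beta>\<^sub>1 s) \<cdot> (\<Sigma> (In2 T Y X') \<cdot> h') = \<Sigma> s \<cdot> h'"
      by (simp add: Comp_left[OF Susp_row_In(2)])
    have "Neg T (\<Sigma> (row T \<beta>\<^sub>1 s)) \<cdot> ?e = Zero T Z' (\<Sigma>\<^sub>o E)" using 1 2 by simp
    then obtain k where [simp]: "k \<in> Arr T" "Dom T k = Z'" "Cod T k = \<Sigma>\<^sub>o X"
      and k: "?e = Neg T (\<Sigma> (col T f (Neg T \<alpha>))) \<cdot> k"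
      by (rule Dist_weak_kernel[OF rotate[OF rotate[OF rotate[OF po']]], rotated 2]) auto
    have "k = Zero T Z' (\<Sigma>\<^sub>o X)" by (rule vanish') auto
    then have "?e = Zero T Z' (\<Sigma>\<^sub>o (Y \<oplus> X'))" using k by (simp del: col_Comp)
    then show ?thesis by (rule diff_eq_Zero) auto
  qed
  \<comment> \<open>\<open>w''\<close> is determined by its restrictions along \<open>a\<close> and \<open>\<sigma>\<close>, the inclusions of the two summands of
    \<open>W\<close>; they are the two columns of the last matrix of the mapping cone.\<close>
  have "w'' = w'' \<cdot> (a \<cdot> r \<boxplus> \<sigma> \<cdot> b)" by (simp add: split)
  also have "\<dots> = (w'' \<cdot> a) \<cdot> r \<boxplus> (w'' \<cdot> \<sigma>) \<cdot> b" by simp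
  also have "\<dots> = Susp_Biprod T Y X' \<cdot> mat T (Neg T (\<Sigma> f)) (Zero T Z' (\<Sigma>\<^sub>o Y)) (\<Sigma> \<alpha>) h' \<cdot> col T r b"
    unfolding a(2) w''\<sigma>
    by (simp add: Susp_Biprod_def mat_def col_def[of _ f] Neg_of_Add Add_assoc row_def[of _ _ h'])
  finally have w'': "w'' = Susp_Biprod T Y X' \<cdot> mat T (Neg T (\<Sigma> f)) (Zero T Z' (\<Sigma>\<^sub>o Y)) (\<Sigma> \<alpha>) h' \<cdot> col T r b" .
  show ?thesis
    unfolding good.simps \<phi>_def[symmetric]
    by (rule Dist_iso[OF W is_iso_Idm is_iso_Idm \<theta>])
      (use w'' in \<open>auto simp: rw' b mat_def Susp_Biprod_def\<close>)
qed

end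

theorem theorem1p5:
  fixes T :: "('o, 'm) triangulated_data"
  assumes "triangulated_category T"
  shows
    "(\<forall>X f Y g Z h X' f' Y' g' Z' h' \<alpha> \<beta> \<gamma>.
        (X, f, Y, g, Z, h) \<in> \<Delta>\<^bsub>T\<^esub> \<longrightarrow> (X', f', Y', g', Z', h') \<in> \<Delta>\<^bsub>T\<^esub> \<longrightarrow>
        triangle_morphism T (X, f, Y, g, Z, h) (X', f', Y', g', Z', h') (\<alpha>, \<beta>, \<gamma>) \<longrightarrow>
        homotopic T (X, f, Y, g, Z, h) (X', f', Y', g', Z', h') (\<alpha>, \<beta>, \<gamma>) \<longrightarrow>
        middling_good T (X, f, Y, g, Z, h) (X', f', Y', g', Z', h') (\<alpha>, \<beta>, \<gamma>)) \<and>
     (\<forall>X f Y g Z h X' f' Y' g' Z' h' \<alpha> \<beta> \<gamma>.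
        (X, f, Y, g, Z, h) \<in> \<Delta>\<^bsub>T\<^esub> \<longrightarrow> (X', f', Y', g', Z', h') \<in> \<Delta>\<^bsub>T\<^esub> \<longrightarrow>
        triangle_morphism T (X, f, Y, g, Z, h) (X', f', Y', g', Z', h') (\<alpha>, \<beta>, \<gamma>) \<longrightarrow>
        homotopic T (X, f, Y, g, Z, h) (X', f', Y', g', Z', h') (\<alpha>, \<beta>, \<gamma>) \<longrightarrow>
        Hom T Z' (\<Sigma>\<^sub>o\<^bsub>T\<^esub> X) = {Zero T Z' (\<Sigma>\<^sub>o\<^bsub>T\<^esub> X)} \<longrightarrow>
        good T (X, f, Y, g, Z, h) (X', f', Y', g', Z', h') (\<alpha>, \<beta>, \<gamma>))"
proof -
  interpret triangulated_category T by fact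
  show ?thesis
    by (intro conjI allI impI; (rule homotopic_imp_middling_good | rule homotopic_imp_good))
qed

end
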